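(* Let $(a,b)\in\mathbb R/\mathbb Z\times[0,1]$ with $(a,b)\notin\overline{\mathcal H}$. Then $f_{a,b}$ is conjugate to the doubling map $D(x)=2x\bmod 1$ by $\phi_{a,b}$; that is, $\phi_{a,b}:\mathbb T\to\mathbb T$ is a homeomorphism with $\phi_{a,b}\circ f_{a,b}=D\circ\phi_{a,b}$.
   Context: Let $\mathbb T=\mathbb R/\mathbb Z$, identified with $[0,1]$ with $0\sim 1$. For $(a,b)\in\mathbb R/\mathbb Z\times[0,1]$ define $f_{a,b}:\mathbb T\to\mathbb T$ by $f_{a,b}(x)=\left(2x+a+\frac b2 S(x)\right)\bmod 1$, where $S(x)=4x-1$ for $x\in[0,\frac12]$ and $S(x)=-4x+3$ for $x\in[\frac12,1)$. A periodic cycle of exact period $p$ is attracting if each of its points has a neighbourhood all of whose points converge to it under iteration of $f_{a,b}^p$. The hyperbolic set is $\mathcal H=\{(a,b)\in\mathbb R/\mathbb Z\times[0,1): f_{a,b}\text{ has an attracting cycle}\}$, and $\overline{\mathcal H}$ is its closure in $\mathbb R/\mathbb Z\times[0,1]$. Let $F_{a,b}:\mathbb R\to\mathbb R$ be the continuous lift of $f_{a,b}$ with $F_{a,b}(0)\in[0,1)$; it satisfies $F_{a,b}(x+k)=F_{a,b}(x)+2k$ for $k\in\mathbb Z$. The limit $\Phi_{a,b}(x)=\lim_{n\to\infty}F_{a,b}^n(x)/2^n$ exists uniformly in $x$, is non-decreasing, satisfies $\Phi_{a,b}(x+k)=\Phi_{a,b}(x)+k$ for $k\in\mathbb Z$,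 and is the lift of a map $\phi_{a,b}:\mathbb T\to\mathbb T$ with $\phi_{a,b}\circ f_{a,b}=D\circ\phi_{a,b}$. *)

theory Defs
  imports "HOL-Analysis.Analysis"
begin

quotient_type circle = real / "\<lambda>x y :: real. x - y \<in> \<int>"
  morphisms rep_circle to_circle
proof (rule equivpI)
  show "reflp (\<lambda>x y :: real. x - y \<in> \<int>)"
    by (simp add: reflp_def)
  show "symp (\<lambda>x y :: real. x - y \<in> \<int>)"
    unfolding symp_def by (metis Ints_minus minus_diff_eq)
  show "transp (\<lambda>x y :: real. x - y \<in> \<int>)"
    unfolding transp_def by (metis Ints_add add_diff_cancel diff_add_eq diff_diff_eq2 diff_add_cancel)
qed

text \<open>The quotient topology of the real line.\<close>

instantiation circle :: topological_space
begin

definition open_circle :: "circle set \<Rightarrow> bool"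
  where "open_circle U \<longleftrightarrow> open (to_circle -` U)"

instance
  by standard (auto simp: open_circle_def vimage_Int vimage_Union)

end

text \<open>The representative in \<open>[0,1)\<close>; the automatically generated \<open>rep_circle\<close> is an
  unspecified one and is not used.\<close>

lift_definition crep :: "circle \<Rightarrow> real" is frac
  by (metis Ints_cases diff_add_cancel frac_add_of_int_left)

definition tent :: "real \<Rightarrow> real"
  where "tent x = (if x \<le> 1/2 then 4 * x - 1 else - 4 * x + 3)"

definition fmap :: "circle \<Rightarrow> real \<Rightarrow> circle \<Rightarrow> circle"
  where "fmap a b x = to_circle (2 * crep x + crep a + b / 2 * tent (crep x))"

definition doubling :: "circle \<Rightarrow> circle"
  where "doubling x = to_circle (2 * crep x)"

definition periodic_cycle :: "('a \<Rightarrow> 'a) \<Rightarrow> nat \<Rightarrow> 'a set \<Rightarrow> bool"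
  where "periodic_cycle f p C \<longleftrightarrow> p > 0 \<and>
    (\<exists>x. (f ^^ p) x = x \<and> (\<forall>q. 0 < q \<and> q < p \<longrightarrow> (f ^^ q) x \<noteq> x) \<and>
         C = (\<lambda>i. (f ^^ i) x) ` {..<p})"

definition attracting_cycle :: "('a::topological_space \<Rightarrow> 'a) \<Rightarrow> nat \<Rightarrow> 'a set \<Rightarrow> bool"
  where "attracting_cycle f p C \<longleftrightarrow> periodic_cycle f p C \<and>
    (\<forall>y\<in>C. \<exists>U. open U \<and> y \<in> U \<and> (\<forall>z\<in>U. (\<lambda>n. ((f ^^ p) ^^ n) z) \<longlonglongrightarrow> y))"

definition hyperbolic_set :: "(circle \<times> real) set"
  where "hyperbolic_set = {(a, b). 0 \<le> b \<and> b < 1 \<and> (\<exists>p C. attracting_cycle (fmap a b) p C)}"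

text \<open>As \<open>UNIV \<times> {0..1}\<close> is closed, closures relative to it are closures in the ambient
  space \<open>circle \<times> real\<close>.\<close>

lemma closure_hyperbolic_set:
  "top_of_set (UNIV \<times> {0..1}) closure_of hyperbolic_set = closure hyperbolic_set"
proof -
  have sub: "hyperbolic_set \<subseteq> UNIV \<times> {0..1}"
    by (auto simp: hyperbolic_set_def)
  have "closed (UNIV \<times> {0..1} :: (circle \<times> real) set)"
    by (intro closed_Times closed_UNIV closed_atLeastAtMost)
  with sub have "closure hyperbolic_set \<subseteq> UNIV \<times> {0..1}"
    by (rule closure_minimal)
  with sub show ?thesis
    by (simp add: closure_of_subtopology Int_absorb1 Int_absorb2)
qed

definition is_lift :: "circle \<Rightarrow> real \<Rightarrow> (real \<Rightarrow> real) \<Rightarrow> bool"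
  where "is_lift a b F \<longleftrightarrow> continuous_on UNIV F \<and>
    (\<forall>x. to_circle (F x) = fmap a b (to_circle x)) \<and> 0 \<le> F 0 \<and> F 0 < 1"

definition lift_map :: "circle \<Rightarrow> real \<Rightarrow> real \<Rightarrow> real"
  where "lift_map a b = (THE F. is_lift a b F)"

lemma to_circle_eq_iff: "to_circle x = to_circle y \<longleftrightarrow> x - y \<in> \<int>"
  by (fact circle.abs_eq_iff)

lemma crep_to_circle: "crep (to_circle x) = frac x"
  by (fact crep.abs_eq)

lemma to_circle_crep: "to_circle (crep x) = x"
proof (induct x)
  case (1 x)
  show ?case
    by (simp add: crep_to_circle to_circle_eq_iff frac_def)
qed

lemma continuous_tent_frac: "continuous_on UNIV (\<lambda>x. tent (frac x))"
proof -
  have *: "tent (frac x) = 1 - 4 * \<bar>x - of_int k - 1/2\<bar>" if "x \<in> {of_int k..of_int (k+1)}" for x and k :: int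
  proof (cases "x = of_int (k+1)")
    case False
    with that have "frac x = x - of_int k"
      by (intro frac_unique_iff[THEN iffD2]) auto
    then show ?thesis by (simp add: tent_def abs_if)
  next
    case True
    then show ?thesis by (simp add: tent_def frac_def)
  qed
  have loc: "continuous_on {of_int k..of_int (k+1)} (\<lambda>x::real. tent (frac x))" for k :: int
    using * by (subst continuous_on_cong[OF refl]) (auto intro!: continuous_intros)
  have loc2: "continuous_on ({of_int (k-1)..of_int k} \<union> {of_int k..of_int (k+1)}) (\<lambda>x::real. tent (frac x))" for k :: int
    using loc[of "k-1"] loc[of k] by (intro continuous_on_closed_Un) auto
  show ?thesis
  proof (intro continuous_at_imp_continuous_on ballI)
    fix x :: real
    define k where "k = \<lfloor>x\<rfloor>"
    have "{of_int (k-1)..of_int k} \<union> {of_int k..of_int (k+1)} = {of_int k - 1..of_int k + (1::real)}"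
      by auto
    with loc2[of k] loc2[of "k"] have c: "continuous_on {of_int k - 1<..<of_int k + (1::real)} (\<lambda>x. tent (frac x))"
      by (metis continuous_on_subset greaterThanLessThan_subseteq_atLeastAtMost_iff order_refl)
    have "x \<in> {of_int k - 1<..<of_int k + 1}"
      unfolding k_def by (simp) linarith
    with c show "isCont (\<lambda>x. tent (frac x)) x"
      using continuous_on_eq_continuous_at[OF open_greaterThanLessThan] by blast
  qed
qed

lemma is_lift_explicit:
  "is_lift a b (\<lambda>x. 2 * x + b / 2 * tent (frac x) + crep a - of_int \<lfloor>crep a - b / 2\<rfloor>)"
  unfolding is_lift_def
proof (intro conjI allI)
  show "continuous_on UNIV (\<lambda>x. 2 * x + b / 2 * tent (frac x) + crep a - of_int \<lfloor>crep a - b / 2\<rfloor>)"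
    by (intro continuous_intros continuous_tent_frac)
  fix x
  have "(2 * x + b / 2 * tent (frac x) + crep a - of_int \<lfloor>crep a - b / 2\<rfloor>)
      - (2 * frac x + crep a + b / 2 * tent (frac x)) = of_int (2 * \<lfloor>x\<rfloor> - \<lfloor>crep a - b / 2\<rfloor>)"
    by (simp add: frac_def)
  also have "\<dots> \<in> \<int>" by (rule Ints_of_int)
  finally show "to_circle (2 * x + b / 2 * tent (frac x) + crep a - of_int \<lfloor>crep a - b / 2\<rfloor>) = fmap a b (to_circle x)"
    by (simp add: fmap_def crep_to_circle to_circle_eq_iff)
next
  have "2 * 0 + b / 2 * tent (frac 0) + crep a - of_int \<lfloor>crep a - b / 2\<rfloor> = frac (crep a - b / 2)"
    by (simp add: tent_def frac_def)
  then show "0 \<le> 2 * 0 + b / 2 * tent (frac 0) + crep a - of_int \<lfloor>crep a - b / 2\<rfloor>"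
    "2 * 0 + b / 2 * tent (frac 0) + crep a - of_int \<lfloor>crep a - b / 2\<rfloor> < 1"
    by (simp_all add: frac_lt_1)
qed

lemma is_lift_unique:
  assumes "is_lift a b F" "is_lift a b G"
  shows "F = G"
proof
  fix x
  have int: "F y - G y \<in> \<int>" for y
    using assms unfolding is_lift_def by (metis to_circle_eq_iff)
  have cont: "continuous_on UNIV (\<lambda>y. F y - G y)"
    using assms unfolding is_lift_def by (intro continuous_intros) auto
  have "(\<lambda>y. F y - G y) constant_on UNIV"
  proof (rule continuous_discrete_range_constant[OF connected_UNIV cont])
    fix y :: real
    have "1 \<le> norm ((F z - G z) - (F y - G y))" if "F z - G z \<noteq> F y - G y" for z
    proof -
      have "(F z - G z) - (F y - G y) \<in> \<int>" by (intro Ints_diff int)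
      with that show ?thesis using Ints_nonzero_abs_ge1 by force
    qed
    then show "\<exists>e>0. \<forall>z. z \<in> UNIV \<and> F z - G z \<noteq> F y - G y \<longrightarrow> e \<le> norm ((F z - G z) - (F y - G y))"
      by (intro exI[of _ 1]) auto
  qed
  then obtain c where "\<And>y. F y - G y = c"
    unfolding constant_on_def by auto
  then have eq: "F x - G x = F 0 - G 0"
    by (simp only:)
  have "\<bar>F 0 - G 0\<bar> < 1"
    using assms unfolding is_lift_def by auto
  with int[of 0] have "F 0 - G 0 = 0"
    using Ints_nonzero_abs_ge1 by force
  with eq show "F x = G x" by simp
qed

lemma is_lift_lift_map: "is_lift a b (lift_map a b)"
  unfolding lift_map_def using is_lift_explicit is_lift_unique by (metis theI)

lemma lift_map_eq:
  "lift_map a b x = 2 * x + b / 2 * tent (frac x) + crep a - of_int \<lfloor>crep a - b / 2\<rfloor>"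
  using is_lift_unique[OF is_lift_lift_map is_lift_explicit] by metis

lemma lift_map_add_int: "lift_map a b (x + of_int k) = lift_map a b x + 2 * of_int k"
  by (simp add: lift_map_eq)

definition Phi :: "circle \<Rightarrow> real \<Rightarrow> real \<Rightarrow> real"
  where "Phi a b x = lim (\<lambda>n. (lift_map a b ^^ n) x / 2 ^ n)"

lemma convergent_Phi: "convergent (\<lambda>n. (lift_map a b ^^ n) x / 2 ^ n)"
proof -
  let ?F = "lift_map a b"
  define M where "M = \<bar>b\<bar> + \<bar>crep a - of_int \<lfloor>crep a - b / 2\<rfloor>\<bar>"
  have bd: "\<bar>?F y - 2 * y\<bar> \<le> M" for y
  proof -
    have "\<bar>tent (frac y)\<bar> \<le> 1"
      using frac_ge_0[of y] frac_lt_1[of y] by (auto simp: tent_def abs_if)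
    then have "\<bar>b / 2 * tent (frac y)\<bar> \<le> \<bar>b\<bar> * 1"
      unfolding abs_mult by (intro mult_mono) auto
    then show ?thesis by (simp add: lift_map_eq M_def)
  qed
  define u where "u n = (?F ^^ n) x / 2 ^ n" for n
  have "summable (\<lambda>n. u (Suc n) - u n)"
  proof (rule summable_comparison_test')
    show "summable (\<lambda>n. M / 2 * (1/2) ^ n)"
      by (intro summable_mult summable_geometric) auto
    fix n :: nat
    have "u (Suc n) - u n = (?F ((?F ^^ n) x) - 2 * (?F ^^ n) x) / (2 * 2 ^ n)"
      by (simp add: u_def diff_divide_distrib)
    also have "norm \<dots> \<le> M / (2 * 2 ^ n)"
      using bd[of "(?F ^^ n) x"] by (simp add: abs_divide divide_right_mono)
    finally show "norm (u (Suc n) - u n) \<le> M / 2 * (1/2) ^ n"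
      by (simp add: power_one_over)
  qed
  then have "convergent (\<lambda>n. \<Sum>i<n. u (Suc i) - u i)"
    by (simp add: summable_iff_convergent)
  then have "convergent (\<lambda>n. u n - u 0)"
    by (simp add: sum_lessThan_telescope)
  then have "convergent u"
    using convergent_diff_const_right_iff[of u "u 0"] by simp
  then show ?thesis by (simp add: u_def[abs_def])
qed

lemma Phi_LIMSEQ: "(\<lambda>n. (lift_map a b ^^ n) x / 2 ^ n) \<longlonglongrightarrow> Phi a b x"
  unfolding Phi_def using convergent_Phi by (simp add: convergent_LIMSEQ_iff)

lemma Phi_add_int: "Phi a b (x + of_int k) = Phi a b x + of_int k"
proof -
  have "(lift_map a b ^^ n) (x + of_int k) = (lift_map a b ^^ n) x + 2 ^ n * of_int k" for n
  proof (induct n)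
    case (Suc n)
    then show ?case
      using lift_map_add_int[of a b "(lift_map a b ^^ n) x" "2 ^ n * k"] by simp
  qed simp
  then have "(\<lambda>n. (lift_map a b ^^ n) (x + of_int k) / 2 ^ n)
      = (\<lambda>n. (lift_map a b ^^ n) x / 2 ^ n + of_int k)"
    by (simp add: add_divide_distrib)
  moreover have "(\<lambda>n. (lift_map a b ^^ n) x / 2 ^ n + of_int k) \<longlonglongrightarrow> Phi a b x + of_int k"
    by (intro tendsto_intros Phi_LIMSEQ)
  ultimately show ?thesis
    using Phi_LIMSEQ[of a b "x + of_int k"] LIMSEQ_unique by metis
qed

definition phi :: "circle \<Rightarrow> real \<Rightarrow> circle \<Rightarrow> circle"
  where "phi a b x = to_circle (Phi a b (crep x))"

text \<open>By the next lemma, \<open>Phi a b\<close> is a lift of \<open>phi a b\<close>, so the choice of representative does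
  not matter.\<close>

lemma phi_to_circle: "phi a b (to_circle x) = to_circle (Phi a b x)"
proof -
  have "Phi a b x = Phi a b (frac x) + of_int \<lfloor>x\<rfloor>"
    using Phi_add_int[of a b "frac x" "\<lfloor>x\<rfloor>"] by (simp add: frac_def)
  then show ?thesis
    by (simp add: phi_def crep_to_circle to_circle_eq_iff)
qed

end

theory Submission
  imports Defs
begin

text \<open>
The lift \<open>\<Phi>\<close> of \<open>\<phi>\<close> is continuous, non-decreasing and commutes with integer translations, so \<open>\<phi>\<close> is
a homeomorphism once \<open>\<Phi>\<close> is injective (\<open>phi_homeomorphism\<close>). It remains to see that a parameter at
which \<open>\<Phi>\<close> is constant on an interval is a limit of parameters with an attracting cycle
(\<open>noninjective_Phi_imp_near_sinks\<close>). Let \<open>F\<close> be the lift, \<open>\<alpha>\<close> a real representative of \<open>a\<close>, and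
\<open>h = F\<^sup>s - m\<close> for integers \<open>s > 0\<close> and \<open>m\<close>; fixed points of such maps \<open>h\<close> are the periodic points
of the circle map.

Since \<open>h\<close> is monotone, an attracting cycle arises wherever the graph of \<open>h\<close> crosses the diagonal
downwards. More generally it suffices, up to a small decrease of \<open>\<alpha>\<close>, that \<open>h u > u\<close> and
\<open>h v \<le> v\<close> for some \<open>u < v\<close> (\<open>trap_imp_near_sinks\<close>). All cases produce such a trap, or an attracting
fixed point directly, after a small perturbation.

For \<open>b = 1\<close> the map has a flat piece, and a perturbation of \<open>\<alpha>\<close> makes the orbit of the flat piece
return to its interior (\<open>flat_piece_imp_near_sinks\<close>).

For \<open>b < 1\<close>, \<open>F\<close> maps fibers of \<open>\<Phi>\<close> onto fibers of \<open>\<Phi>\<close>. If the value \<open>t\<close> of \<open>\<Phi>\<close> on the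
interval is preperiodic under doubling modulo 1, some fiber is invariant under a map \<open>h\<close>. Unless \<open>h\<close> is the
identity there, a trap is found inside the fiber; an interval of fixed points gives an attracting one
when \<open>b\<close> is increased and \<open>\<alpha>\<close> is adjusted (\<open>periodic_interval_imp_near_sinks\<close>).

If \<open>t\<close> is not preperiodic, the interval is wandering. By maximality of the fiber its images must
come close to the integers from the left, in the pieces of slope \<open>2 - 2 b\<close>, at distances so small that an
integer to the right of one image is nearly mapped to an integer to the right of a later, shorter
image. Lowering \<open>\<alpha>\<close> a little closes this orbit. On the left side of the periodic point obtained, the
return map is still contracting, because in these pieces the orbit is squeezed between the
images of the interval and the integers (\<open>wandering_interval_imp_near_sinks\<close>).
\<close>

section \<open>The family of lifts\<close>

text \<open>The lift \<open>x \<mapsto> 2 x + \<alpha> + b/2 S(x)\<close> with a real translation parameter \<open>\<alpha>\<close>. Perturbation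
arguments move \<open>\<alpha>\<close> continuously, which the normalization of \<^const>\<open>lift_map\<close> would interrupt by
integer jumps.\<close>
definition pl :: "real \<Rightarrow> real \<Rightarrow> real \<Rightarrow> real"
  where "pl \<alpha> b x = 2 * x + \<alpha> + b / 2 * tent (frac x)"

text \<open>The periodic tent is the maximum of the integer translates of a single tent; the inequality
below is one direction of this, and it gives the Lipschitz constant 4 without a case distinction on the
position of the two points.\<close>
lemma tent_frac_ge: "tent (frac x) \<ge> 1 - 4 * \<bar>x - of_int k - 1/2\<bar>"
proof -
  have r: "0 \<le> frac x" "frac x < 1" by (simp_all add: frac_lt_1)
  show ?thesis
  proof (cases "k = \<lfloor>x\<rfloor>")
    case True
    then show ?thesis using r unfolding tent_def frac_def by (auto simp: abs_if)
  next
    case False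
    then have "real_of_int k \<le> of_int \<lfloor>x\<rfloor> - 1 \<or> real_of_int k \<ge> of_int \<lfloor>x\<rfloor> + 1" by linarith
    then have "1/2 \<le> \<bar>x - of_int k - 1/2\<bar>" by linarith
    then have "1 - 4 * \<bar>x - of_int k - 1/2\<bar> \<le> -1" by argo
    also have "-1 \<le> tent (frac x)" using r by (auto simp: tent_def)
    finally show ?thesis .
  qed
qed

lemma tent_frac_eq:
  assumes "of_int k \<le> x" "x \<le> of_int k + 1"
  shows "tent (frac x) = 1 - 4 * \<bar>x - of_int k - 1/2\<bar>"
proof (cases "x = of_int k + 1")
  case True
  then show ?thesis by (simp add: tent_def frac_def)
next
  case False
  then have "\<lfloor>x\<rfloor> = k" using assms by linarith
  then show ?thesis using assms False by (auto simp: tent_def frac_def abs_if)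
qed

lemma tent_frac_Lipschitz: "\<bar>tent (frac y) - tent (frac x)\<bar> \<le> 4 * \<bar>y - x\<bar>"
proof -
  have *: "tent (frac y) - tent (frac x) \<le> 4 * \<bar>y - x\<bar>" for x y :: real
  proof -
    have "tent (frac y) = 1 - 4 * \<bar>y - of_int \<lfloor>y\<rfloor> - 1/2\<bar>"
      by (rule tent_frac_eq) linarith+
    with tent_frac_ge[where k = "\<lfloor>y\<rfloor>" and x = x] show ?thesis by (simp add: abs_if split: if_splits)
  qed
  from *[of y x] *[of x y] show ?thesis by (simp add: abs_le_iff abs_minus_commute)
qed

lemma pl_expanding:
  assumes "of_int k \<le> x" "x \<le> y" "y \<le> of_int k + 1/2"
  shows "pl \<alpha> b y - pl \<alpha> b x = (2 + 2 * b) * (y - x)"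
proof -
  have "tent (frac z) = 4 * (z - of_int k) - 1" if "of_int k \<le> z" "z \<le> of_int k + 1/2" for z
    using tent_frac_eq[of k z] that by (simp add: abs_if)
  with assms have "tent (frac y) = 4 * (y - of_int k) - 1" "tent (frac x) = 4 * (x - of_int k) - 1"
    by auto
  then show ?thesis by (simp only: pl_def) (simp add: field_simps)
qed

lemma pl_contracting:
  assumes "of_int k + 1/2 \<le> x" "x \<le> y" "y \<le> of_int k + 1"
  shows "pl \<alpha> b y - pl \<alpha> b x = (2 - 2 * b) * (y - x)"
proof -
  have "tent (frac z) = 3 - 4 * (z - of_int k)" if "of_int k + 1/2 \<le> z" "z \<le> of_int k + 1" for z
    using tent_frac_eq[of k z] that by (simp add: abs_if)
  with assms have "tent (frac y) = 3 - 4 * (y - of_int k)" "tent (frac x) = 3 - 4 * (x - of_int k)"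
    by auto
  then show ?thesis by (simp only: pl_def) (simp add: field_simps)
qed

lemma pl_upper:
  assumes "0 \<le> b" "x \<le> y"
  shows "pl \<alpha> b y - pl \<alpha> b x \<le> (2 + 2 * b) * (y - x)"
proof -
  have "b / 2 * (tent (frac y) - tent (frac x)) \<le> b / 2 * (4 * (y - x))"
    using tent_frac_Lipschitz[of y x] assms by (intro mult_left_mono) auto
  then show ?thesis by (simp add: pl_def algebra_simps)
qed

lemma pl_lower:
  assumes "0 \<le> b" "x \<le> y"
  shows "(2 - 2 * b) * (y - x) \<le> pl \<alpha> b y - pl \<alpha> b x"
proof -
  have "b / 2 * (tent (frac x) - tent (frac y)) \<le> b / 2 * (4 * (y - x))"
    using tent_frac_Lipschitz[of y x] assms by (intro mult_left_mono) auto
  then show ?thesis by (simp add: pl_def algebra_simps)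
qed

lemma pl_mono:
  assumes "0 \<le> b" "b \<le> 1" "x \<le> y"
  shows "pl \<alpha> b x \<le> pl \<alpha> b y"
proof -
  have "0 \<le> (2 - 2 * b) * (y - x)" using assms by simp
  with pl_lower[OF assms(1,3), of \<alpha>] show ?thesis by linarith
qed

lemma pl_strict_mono:
  assumes "0 \<le> b" "b < 1" "x < y"
  shows "pl \<alpha> b x < pl \<alpha> b y"
proof -
  have "0 < (2 - 2 * b) * (y - x)" using assms by simp
  with pl_lower[of b x y \<alpha>] assms show ?thesis by linarith
qed

lemma pl_iter_mono:
  assumes "0 \<le> b" "b \<le> 1" "x \<le> y"
  shows "(pl \<alpha> b ^^ n) x \<le> (pl \<alpha> b ^^ n) y"
  by (induct n) (use assms in \<open>auto intro: pl_mono\<close>)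

lemma pl_iter_strict_mono:
  assumes "0 \<le> b" "b < 1" "x < y"
  shows "(pl \<alpha> b ^^ n) x < (pl \<alpha> b ^^ n) y"
  by (induct n) (use assms in \<open>auto intro: pl_strict_mono\<close>)

lemma pl_iter_less_iff:
  assumes "0 \<le> b" "b < 1"
  shows "(pl \<alpha> b ^^ n) x < (pl \<alpha> b ^^ n) y \<longleftrightarrow> x < y"
  using pl_iter_strict_mono[OF assms] by (metis less_asym linorder_neqE_linordered_idom)

lemma continuous_on_pl [continuous_intros]:
  assumes "continuous_on S f" "continuous_on S g" "continuous_on S h"
  shows "continuous_on S (\<lambda>z. pl (f z) (g z) (h z))"
  unfolding pl_def
  by (intro continuous_intros assms continuous_on_compose2[OF continuous_tent_frac assms(3)]) auto

lemma continuous_on_pl_iter [continuous_intros]: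
  assumes "continuous_on S f" "continuous_on S g" "continuous_on S h"
  shows "continuous_on S (\<lambda>z. (pl (f z) (g z) ^^ n) (h z))"
  by (induct n) (auto intro!: continuous_intros assms)

lemma pl_add_int: "pl \<alpha> b (x + of_int k) = pl \<alpha> b x + of_int (2 * k)"
  by (simp add: pl_def)

lemma pl_iter_add_int: "(pl \<alpha> b ^^ n) (x + of_int k) = (pl \<alpha> b ^^ n) x + of_int (2 ^ n * k)"
proof (induct n)
  case (Suc n)
  have "(pl \<alpha> b ^^ Suc n) (x + of_int k) = pl \<alpha> b ((pl \<alpha> b ^^ n) x + of_int (2 ^ n * k))"
    by (simp only: funpow.simps comp_apply Suc)
  then show ?case by (simp only: pl_add_int) simp
qed simp

lemma pl_iter_mono_param:
  assumes "0 \<le> b" "b \<le> 1" "\<alpha>' \<le> \<alpha>" "x \<le> y"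
  shows "(pl \<alpha>' b ^^ n) x \<le> (pl \<alpha> b ^^ n) y"
proof (induct n)
  case (Suc n)
  have "pl \<alpha>' b ((pl \<alpha>' b ^^ n) x) \<le> pl \<alpha>' b ((pl \<alpha> b ^^ n) y)"
    using Suc assms by (intro pl_mono)
  also have "\<dots> \<le> pl \<alpha> b ((pl \<alpha> b ^^ n) y)" using assms by (simp add: pl_def)
  finally show ?case by simp
qed (use assms in simp)

text \<open>Lowering \<open>\<alpha>\<close> acts at every step and the maps are non-decreasing, so the last step alone
already moves the image at unit speed. This is what lets the intermediate value theorem solve
equations \<open>F\<^sup>s x = x + m\<close> by a parameter change of controlled size.\<close>
lemma pl_iter_speed_param:
  assumes "0 \<le> b" "b \<le> 1" "\<alpha>' \<le> \<alpha>" "n > 0"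
  shows "(pl \<alpha> b ^^ n) x - (pl \<alpha>' b ^^ n) x \<ge> \<alpha> - \<alpha>'"
proof -
  obtain m where m: "n = Suc m" using assms(4) by (cases n) auto
  have "pl \<alpha>' b ((pl \<alpha>' b ^^ m) x) \<le> pl \<alpha>' b ((pl \<alpha> b ^^ m) x)"
    using assms by (intro pl_mono pl_iter_mono_param) auto
  then show ?thesis by (simp add: m pl_def)
qed

section \<open>Descent to the circle\<close>

lemma fmap_to_circle: "fmap (to_circle \<alpha>) b (to_circle x) = to_circle (pl \<alpha> b x)"
proof -
  have "2 * frac x + frac \<alpha> + b / 2 * tent (frac x) - pl \<alpha> b x = of_int (- 2 * \<lfloor>x\<rfloor> - \<lfloor>\<alpha>\<rfloor>)"
    by (simp add: pl_def frac_def)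
  then show ?thesis by (simp add: fmap_def crep_to_circle to_circle_eq_iff)
qed

lemma fmap_iter_to_circle: "(fmap (to_circle \<alpha>) b ^^ n) (to_circle x) = to_circle ((pl \<alpha> b ^^ n) x)"
  by (induct n) (simp_all add: fmap_to_circle)

lemma continuous_to_circle: "continuous_on UNIV to_circle"
  by (simp add: continuous_on_open_vimage open_circle_def[symmetric])

lemma open_to_circle_image:
  assumes "open A" shows "open (to_circle ` A)"
proof -
  have "to_circle -` (to_circle ` A) = (\<Union>k::int. (\<lambda>x. of_int k + x) ` A)"
  proof (intro set_eqI iffI)
    fix x assume "x \<in> to_circle -` (to_circle ` A)"
    then obtain y where y: "y \<in> A" "x - y \<in> \<int>" by (auto simp: to_circle_eq_iff)
    then obtain k where "x - y = of_int k" by (auto elim: Ints_cases)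
    then have "x = of_int k + y" by simp
    with y show "x \<in> (\<Union>k::int. (\<lambda>x. of_int k + x) ` A)" by blast
  next
    fix x assume "x \<in> (\<Union>k::int. (\<lambda>x. of_int k + x) ` A)"
    then obtain k :: int and y where y: "y \<in> A" "x = of_int k + y" by auto
    then have "to_circle x = to_circle y" by (simp add: to_circle_eq_iff)
    with y show "x \<in> to_circle -` (to_circle ` A)" by auto
  qed
  with assms show ?thesis by (auto simp: open_circle_def intro!: open_translation)
qed

lemma tendsto_to_circle: "(X \<longlongrightarrow> l) F \<Longrightarrow> ((\<lambda>n. to_circle (X n)) \<longlongrightarrow> to_circle l) F"
  using continuous_on_tendsto_compose[OF continuous_to_circle] by (simp add: o_def)

section \<open>Sinks and hyperbolic parameters\<close>

text \<open>A fixed point of \<open>F\<^sup>s - m\<close> at which the graph crosses the diagonal downwards. Such a point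
attracts a neighbourhood because \<open>F\<^sup>s - m\<close> is monotone; no bound on a derivative is involved.\<close>
definition sink :: "real \<Rightarrow> real \<Rightarrow> bool"
  where "sink \<alpha> b \<longleftrightarrow> (\<exists>s>0. \<exists>m::int. \<exists>x0. \<exists>\<eta>>0. (pl \<alpha> b ^^ s) x0 = x0 + of_int m \<and>
    (\<forall>x. x0 < x \<and> x < x0 + \<eta> \<longrightarrow> (pl \<alpha> b ^^ s) x < x + of_int m) \<and>
    (\<forall>x. x0 - \<eta> < x \<and> x < x0 \<longrightarrow> (pl \<alpha> b ^^ s) x > x + of_int m))"

lemma funpow_tendsto_right:
  fixes g :: "real \<Rightarrow> real"
  assumes "continuous_on UNIV g" "mono g" "g x0 = x0"
    and below: "\<And>x. x0 < x \<Longrightarrow> x < x0 + \<eta> \<Longrightarrow> g x < x"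
    and x: "x0 \<le> x" "x < x0 + \<eta>"
  shows "(\<lambda>n. (g ^^ n) x) \<longlonglongrightarrow> x0"
proof -
  have le: "g y \<le> y" if "x0 \<le> y" "y < x0 + \<eta>" for y
    using below[of y] that assms(3) by (cases "y = x0") auto
  have bnd: "x0 \<le> (g ^^ n) x \<and> (g ^^ n) x \<le> x" for n
  proof (induct n)
    case (Suc n)
    then have "x0 \<le> g ((g ^^ n) x)" using assms(2,3) by (metis monoD)
    moreover have "g ((g ^^ n) x) \<le> (g ^^ n) x" using Suc x by (intro le) auto
    ultimately show ?case using Suc by simp
  qed (use x in simp)
  have "decseq (\<lambda>n. (g ^^ n) x)"
    unfolding decseq_Suc_iff using bnd x le by (metis comp_apply funpow.simps(2) le_less_trans)
  then obtain l where l: "(\<lambda>n. (g ^^ n) x) \<longlonglongrightarrow> l"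
    using decseq_convergent[of _ x0] bnd by metis
  have "(\<lambda>n. g ((g ^^ n) x)) \<longlonglongrightarrow> g l"
    using continuous_on_tendsto_compose[OF assms(1) l] by simp
  moreover have "(\<lambda>n. g ((g ^^ n) x)) \<longlonglongrightarrow> l"
    using LIMSEQ_Suc[OF l] by simp
  ultimately have gl: "g l = l" by (rule LIMSEQ_unique)
  have "x0 \<le> l" "l \<le> x"
    using LIMSEQ_le_const[OF l] LIMSEQ_le_const2[OF l] bnd by blast+
  with below[of l] gl x have "l = x0" by force
  with l show ?thesis by simp
qed

lemma funpow_tendsto:
  fixes g :: "real \<Rightarrow> real"
  assumes "continuous_on UNIV g" "mono g" "g x0 = x0"
    and below: "\<And>x. x0 < x \<Longrightarrow> x < x0 + \<eta> \<Longrightarrow> g x < x"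
    and above: "\<And>x. x0 - \<eta> < x \<Longrightarrow> x < x0 \<Longrightarrow> g x > x"
    and x: "\<bar>x - x0\<bar> < \<eta>"
  shows "(\<lambda>n. (g ^^ n) x) \<longlonglongrightarrow> x0"
proof (cases "x0 \<le> x")
  case True
  then show ?thesis using assms by (intro funpow_tendsto_right[where \<eta> = \<eta>]) auto
next
  case False
  define g' where "g' y = - g (- y)" for y
  have it: "(g' ^^ n) (- x) = - (g ^^ n) x" for n
    by (induct n) (auto simp: g'_def)
  have lt: "g' y < y" if "- x0 < y" "y < - x0 + \<eta>" for y
    using above[of "- y"] that by (simp add: g'_def)
  have "continuous_on UNIV g'" unfolding g'_def
    by (intro continuous_intros continuous_on_compose2[OF assms(1)]) auto
  moreover have "mono g'" using assms(2) by (auto simp: g'_def mono_def)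
  ultimately have "(\<lambda>n. (g' ^^ n) (- x)) \<longlonglongrightarrow> - x0"
    using False x assms(3) lt
    by (intro funpow_tendsto_right[where \<eta> = \<eta>]) (auto simp: g'_def)
  then show ?thesis unfolding it using tendsto_minus by fastforce
qed

lemma funpow_ge_self:
  fixes g :: "real \<Rightarrow> real"
  assumes "mono g" "x \<le> g x" shows "x \<le> (g ^^ n) x"
  by (induct n) (use assms in \<open>auto intro: order_trans dest: monoD\<close>)

lemma funpow_le_self:
  fixes g :: "real \<Rightarrow> real"
  assumes "mono g" "g x \<le> x" shows "(g ^^ n) x \<le> x"
  by (induct n) (use assms in \<open>auto intro: order_trans dest: monoD\<close>)

lemma pl_iter_shift_iter:
  fixes m :: int
  shows "\<exists>M::int. \<forall>x. ((\<lambda>x. (pl \<alpha> b ^^ p) x - of_int m) ^^ n) x = (pl \<alpha> b ^^ (p * n)) x + of_int M"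
proof (induct n)
  case 0 show ?case by (rule exI[of _ 0]) simp
next
  case (Suc n)
  then obtain M where M: "((\<lambda>x. (pl \<alpha> b ^^ p) x - of_int m) ^^ n) x = (pl \<alpha> b ^^ (p * n)) x + of_int M" for x by auto
  have "((\<lambda>x. (pl \<alpha> b ^^ p) x - of_int m) ^^ Suc n) x = (pl \<alpha> b ^^ (p * Suc n)) x + of_int (2 ^ p * M - m)" for x
    by (simp only: funpow.simps comp_apply M pl_iter_add_int mult_Suc_right funpow_add of_int_diff of_int_add add_diff_eq)
  then show ?case by blast
qed

text \<open>The number \<open>s\<close> of a sink is only a multiple of the exact period \<open>p\<close>. For \<open>h = F\<^sup>p - m'\<close> the
given map is an iterate of \<open>h\<close>, and a monotone \<open>h\<close> cannot move a point in the direction opposite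
to that of its iterate; hence \<open>h\<close> crosses the diagonal downwards as well. The other points of the
cycle inherit attracting neighbourhoods through the homeomorphisms \<open>F\<^sup>i\<close>.\<close>
lemma sink_imp_hyperbolic:
  assumes b: "0 \<le> b" "b < 1" and "sink \<alpha> b"
  shows "(to_circle \<alpha>, b) \<in> hyperbolic_set"
proof -
  let ?F = "pl \<alpha> b"
  obtain s and m :: int and x0 \<eta> where s: "s > 0" "\<eta> > 0" and fx: "(?F ^^ s) x0 = x0 + of_int m"
    and R: "\<And>x. x0 < x \<Longrightarrow> x < x0 + \<eta> \<Longrightarrow> (?F ^^ s) x < x + of_int m"
    and L: "\<And>x. x0 - \<eta> < x \<Longrightarrow> x < x0 \<Longrightarrow> (?F ^^ s) x > x + of_int m"
    using assms(3) unfolding sink_def by blast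
  define f where "f = fmap (to_circle \<alpha>) b"
  define X where "X = to_circle x0"
  have fi: "(f ^^ n) (to_circle x) = to_circle ((?F ^^ n) x)" for n x
    unfolding f_def by (rule fmap_iter_to_circle)
  have fs: "(f ^^ s) X = X" by (simp add: X_def fi fx to_circle_eq_iff)
  define p where "p = (LEAST p. p > 0 \<and> (f ^^ p) X = X)"
  have p: "p > 0 \<and> (f ^^ p) X = X" unfolding p_def by (rule LeastI[of _ s]) (use s fs in auto)
  have pmin: "(f ^^ q) X \<noteq> X" if "0 < q" "q < p" for q
    using not_less_Least[of q "\<lambda>p. p > 0 \<and> (f ^^ p) X = X"] that unfolding p_def by auto
  have "(f ^^ (s mod p)) X = X" using p fs by (simp add: funpow_mod_eq)
  then have "s mod p = 0" using pmin[of "s mod p"] p by fastforce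
  then obtain q where q: "s = p * q" by (auto simp: mod_eq_0_iff_dvd dvd_def)
  have "to_circle ((?F ^^ p) x0) = to_circle x0" using p by (simp add: X_def fi)
  then obtain m' :: int where m': "(?F ^^ p) x0 - x0 = of_int m'"
    by (auto simp: to_circle_eq_iff elim: Ints_cases)
  define h where "h = (\<lambda>x. (?F ^^ p) x - of_int m')"
  have h_it: "\<exists>M::int. \<forall>x. (h ^^ n) x = (?F ^^ (p * n)) x + of_int M" for n
    unfolding h_def by (rule pl_iter_shift_iter)
  have hx0: "h x0 = x0" using m' by (simp add: h_def)
  have hmono: "mono h" using b by (auto simp: mono_def h_def intro!: pl_iter_mono)
  have hcont: "continuous_on UNIV h" unfolding h_def by (intro continuous_intros)
  obtain M :: int where M: "\<And>x. (h ^^ q) x = (?F ^^ s) x + of_int M" using h_it[of q] q by auto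
  have "(h ^^ q) x0 = x0" using hx0 by (induct q) auto
  with M[of x0] fx have "of_int M = - real_of_int m" by simp
  with M have hq: "(h ^^ q) x = (?F ^^ s) x - of_int m" for x by simp
  \<comment> \<open>If \<open>h x \<ge> x\<close>, then \<open>h\<^sup>q x \<ge> x\<close> by monotonicity, against the hypothesis on \<open>F\<^sup>s\<close>.\<close>
  have hR: "h x < x" if "x0 < x" "x < x0 + \<eta>" for x
    using R[OF that] funpow_ge_self[OF hmono, of x q] hq[of x] by force
  have hL: "h x > x" if "x0 - \<eta> < x" "x < x0" for x
    using L[OF that] funpow_le_self[OF hmono, of x q] hq[of x] by force
  have conv: "(\<lambda>n. (h ^^ n) x) \<longlonglongrightarrow> x0" if "\<bar>x - x0\<bar> < \<eta>" for x
    using funpow_tendsto[OF hcont hmono hx0 hR hL that] .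
  define C where "C = (\<lambda>i. (f ^^ i) X) ` {..<p}"
  have "periodic_cycle f p C"
    unfolding periodic_cycle_def C_def using p pmin by blast
  moreover have "\<exists>U. open U \<and> y \<in> U \<and> (\<forall>z\<in>U. (\<lambda>n. ((f ^^ p) ^^ n) z) \<longlonglongrightarrow> y)" if y: "y \<in> C" for y
  proof -
    obtain i where i: "y = (f ^^ i) X" using y by (auto simp: C_def)
    define A where "A = (?F ^^ i) ` {x0 - \<eta><..<x0 + \<eta>}"
    have "open A" unfolding A_def
    proof (rule injective_into_1d_imp_open_map_UNIV)
      show "inj_on (?F ^^ i) UNIV"
        by (rule inj_onI) (metis pl_iter_less_iff[OF b] linorder_neqE_linordered_idom less_irrefl)
    qed (auto intro!: continuous_intros)
    then have "open (to_circle ` A)" by (rule open_to_circle_image)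
    moreover have "y \<in> to_circle ` A"
      using s by (auto simp: i X_def fi A_def)
    moreover have "(\<lambda>n. ((f ^^ p) ^^ n) z) \<longlonglongrightarrow> y" if z: "z \<in> to_circle ` A" for z
    proof -
      obtain x where x: "\<bar>x - x0\<bar> < \<eta>" "z = to_circle ((?F ^^ i) x)"
        using z by (auto simp: A_def abs_less_iff intro!: that)
      have eq: "((f ^^ p) ^^ n) z = to_circle ((?F ^^ i) ((h ^^ n) x))" for n
      proof -
        obtain M :: int where M: "(h ^^ n) x = (?F ^^ (p * n)) x + of_int M" using h_it[of n] by auto
        have "((f ^^ p) ^^ n) z = to_circle ((?F ^^ (p * n)) ((?F ^^ i) x))"
          by (simp add: x fi funpow_mult mult.commute)
        also have "(?F ^^ (p * n)) ((?F ^^ i) x) = (?F ^^ i) ((?F ^^ (p * n)) x)"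
          by (metis add.commute comp_apply funpow_add)
        also have "to_circle \<dots> = to_circle ((?F ^^ i) ((h ^^ n) x))"
          by (simp add: M pl_iter_add_int to_circle_eq_iff del: of_int_add of_int_mult of_int_power)
        finally show ?thesis .
      qed
      have "(\<lambda>n. (?F ^^ i) ((h ^^ n) x)) \<longlonglongrightarrow> (?F ^^ i) x0"
        by (rule continuous_on_tendsto_compose[where s = UNIV, OF _ conv[OF x(1)]]) (auto intro!: continuous_intros)
      from tendsto_to_circle[OF this] show ?thesis by (simp add: eq i X_def fi)
    qed
    ultimately show ?thesis by blast
  qed
  ultimately show ?thesis
    using b unfolding hyperbolic_set_def attracting_cycle_def f_def by blast
qed

section \<open>Approximation by sinks\<close>

text \<open>Stands for membership of \<open>(to_circle \<alpha>, b)\<close> in the closure of the hyperbolic set. Real parameters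
make the perturbations of \<open>\<alpha>\<close> measurable by distances.\<close>
definition near_sinks :: "real \<Rightarrow> real \<Rightarrow> bool"
  where "near_sinks \<alpha> b \<longleftrightarrow>
    (\<forall>\<epsilon>>0. \<exists>\<alpha>' b'. \<bar>\<alpha>' - \<alpha>\<bar> < \<epsilon> \<and> \<bar>b' - b\<bar> < \<epsilon> \<and> 0 \<le> b' \<and> b' < 1 \<and> sink \<alpha>' b')"

lemma near_sinks_imp_closure:
  assumes "near_sinks \<alpha> b"
  shows "(to_circle \<alpha>, b) \<in> closure hyperbolic_set"
proof -
  have "\<forall>n. \<exists>\<alpha>' b'. \<bar>\<alpha>' - \<alpha>\<bar> < inverse (real (Suc n)) \<and> \<bar>b' - b\<bar> < inverse (real (Suc n)) \<and> 0 \<le> b' \<and> b' < 1 \<and> sink \<alpha>' b'"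
    using assms unfolding near_sinks_def by simp
  then obtain A B where AB: "\<And>n. \<bar>A n - \<alpha>\<bar> < inverse (real (Suc n))" "\<And>n. \<bar>B n - b\<bar> < inverse (real (Suc n))"
    "\<And>n. 0 \<le> B n" "\<And>n. B n < 1" "\<And>n. sink (A n) (B n)"
    by metis
  have lim: "f \<longlonglongrightarrow> l" if "\<And>n. \<bar>f n - l\<bar> < inverse (real (Suc n))" for f :: "nat \<Rightarrow> real" and l
  proof -
    have "(\<lambda>n. f n - l) \<longlonglongrightarrow> 0"
      by (rule Lim_null_comparison[OF _ LIMSEQ_inverse_real_of_nat])
         (use that in \<open>auto intro!: always_eventually less_imp_le simp del: of_nat_Suc\<close>)
    then show ?thesis by (simp add: LIM_zero_iff)
  qed
  have "(\<lambda>n. (to_circle (A n), B n)) \<longlonglongrightarrow> (to_circle \<alpha>, b)"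
    by (intro tendsto_Pair tendsto_to_circle lim AB)
  moreover have "(to_circle (A n), B n) \<in> closure hyperbolic_set" for n
    using sink_imp_hyperbolic[OF AB(3-5)] closure_subset by blast
  ultimately show ?thesis
    by (intro Lim_in_closed_set[where F = sequentially]) auto
qed

lemma near_sinks_trans:
  assumes "\<And>\<epsilon>. \<epsilon> > 0 \<Longrightarrow> \<exists>\<alpha>' b'. \<bar>\<alpha>' - \<alpha>\<bar> < \<epsilon> \<and> \<bar>b' - b\<bar> < \<epsilon> \<and> near_sinks \<alpha>' b'"
  shows "near_sinks \<alpha> b"
  unfolding near_sinks_def
proof (intro allI impI)
  fix \<epsilon> :: real assume "\<epsilon> > 0"
  then have e: "\<epsilon> / 2 > 0" by simp
  from assms[OF e] obtain \<alpha>' b' where 1: "\<bar>\<alpha>' - \<alpha>\<bar> < \<epsilon> / 2" "\<bar>b' - b\<bar> < \<epsilon> / 2" "near_sinks \<alpha>' b'" by auto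
  from 1(3) e obtain \<alpha>'' b'' where 2: "\<bar>\<alpha>'' - \<alpha>'\<bar> < \<epsilon> / 2" "\<bar>b'' - b'\<bar> < \<epsilon> / 2" "0 \<le> b''" "b'' < 1" "sink \<alpha>'' b''"
    unfolding near_sinks_def by blast
  have "\<bar>\<alpha>'' - \<alpha>\<bar> < \<epsilon>" "\<bar>b'' - b\<bar> < \<epsilon>" using 1 2 by linarith+
  with 2 show "\<exists>\<alpha>' b'. \<bar>\<alpha>' - \<alpha>\<bar> < \<epsilon> \<and> \<bar>b' - b\<bar> < \<epsilon> \<and> 0 \<le> b' \<and> b' < 1 \<and> sink \<alpha>' b'"
    by blast
qed

text \<open>An interval on which \<open>F\<^sup>s - m\<close> passes from above the diagonal to the diagonal or below it. The
inequality at \<open>v\<close> is weak so that a fixed point attracting from the left only, which occurs when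
its orbit meets a turning point, also counts.\<close>
definition trap :: "real \<Rightarrow> real \<Rightarrow> bool"
  where "trap \<alpha> b \<longleftrightarrow> (\<exists>s>0. \<exists>m::int. \<exists>u v. u < v \<and>
    (pl \<alpha> b ^^ s) u > u + of_int m \<and> (pl \<alpha> b ^^ s) v \<le> v + of_int m)"

lemma pl_left_affine:
  assumes "0 \<le> b" "b < 1"
  obtains e \<sigma> where "e > 0" "\<sigma> > 0"
    "\<And>\<alpha> x y. z - e \<le> x \<Longrightarrow> x \<le> y \<Longrightarrow> y \<le> z \<Longrightarrow> pl \<alpha> b y - pl \<alpha> b x = \<sigma> * (y - x)"
proof -
  define k where "k = \<lceil>2 * z\<rceil> - 1"
  have k: "of_int k < 2 * z" "2 * z \<le> of_int k + 1"
    unfolding k_def by linarith+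
  define e where "e = z - of_int k / 2"
  have e: "e > 0" using k by (simp add: e_def)
  show thesis
  proof (cases "even k")
    case True
    then obtain j where "k = 2 * j" by (auto elim: evenE)
    then have "pl \<alpha> b y - pl \<alpha> b x = (2 + 2 * b) * (y - x)" if "z - e \<le> x" "x \<le> y" "y \<le> z" for \<alpha> x y
      using that k by (intro pl_expanding[of j]) (auto simp: e_def)
    with e show thesis using assms by (intro that[of e "2 + 2 * b"]) auto
  next
    case False
    then obtain j where "k = 2 * j + 1" by (auto elim: oddE)
    then have "pl \<alpha> b y - pl \<alpha> b x = (2 - 2 * b) * (y - x)" if "z - e \<le> x" "x \<le> y" "y \<le> z" for \<alpha> x y
      using that k by (intro pl_contracting[of j]) (auto simp: e_def)
    with e show thesis using assms by (intro that[of e "2 - 2 * b"]) auto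
  qed
qed

text \<open>The slope \<open>\<mu>\<close> does not depend on \<open>\<alpha>' \<le> \<alpha>\<close>: lowering the parameter moves the orbit of \<open>y\<close> to the
left, hence never over a turning point that lies on the orbit itself.\<close>
lemma pl_iter_left_affine:
  assumes b: "0 \<le> b" "b < 1"
  shows "\<exists>\<eta>>0. \<exists>\<mu>>0. \<exists>\<kappa>>0. \<forall>\<alpha>'\<in>{\<alpha> - \<kappa>..\<alpha>}. \<forall>x\<in>{y - \<eta>..y}.
           (pl \<alpha>' b ^^ n) y - (pl \<alpha>' b ^^ n) x = \<mu> * (y - x)"
proof (induct n)
  case 0
  show ?case by (rule exI[of _ 1], simp, rule exI[of _ 1], simp, rule exI[of _ 1], simp)
next
  case (Suc n)
  then obtain \<eta> \<mu> \<kappa> where pos: "\<eta> > 0" "\<mu> > 0" "\<kappa> > 0"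
    and aff: "\<And>\<alpha>' x. \<alpha> - \<kappa> \<le> \<alpha>' \<Longrightarrow> \<alpha>' \<le> \<alpha> \<Longrightarrow> y - \<eta> \<le> x \<Longrightarrow> x \<le> y \<Longrightarrow>
       (pl \<alpha>' b ^^ n) y - (pl \<alpha>' b ^^ n) x = \<mu> * (y - x)" by auto
  define z where "z = (pl \<alpha> b ^^ n) y"
  obtain e \<sigma> where e: "e > 0" "\<sigma> > 0"
    and loc: "\<And>\<alpha> x y. z - e \<le> x \<Longrightarrow> x \<le> y \<Longrightarrow> y \<le> z \<Longrightarrow> pl \<alpha> b y - pl \<alpha> b x = \<sigma> * (y - x)"
    using pl_left_affine[OF b] by metis
  have "continuous_on UNIV (\<lambda>\<alpha>. (pl \<alpha> b ^^ n) y)" by (intro continuous_intros)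
  then have "isCont (\<lambda>\<alpha>. (pl \<alpha> b ^^ n) y) \<alpha>" by (simp add: continuous_on_eq_continuous_at)
  then obtain d where d: "d > 0" "\<And>\<alpha>'. \<bar>\<alpha>' - \<alpha>\<bar> < d \<Longrightarrow> \<bar>(pl \<alpha>' b ^^ n) y - z\<bar> < e / 2"
    unfolding continuous_at_eps_delta z_def using e by (metis half_gt_zero dist_real_def)
  define \<eta>' where "\<eta>' = min \<eta> (e / (2 * \<mu>))"
  define \<kappa>' where "\<kappa>' = min \<kappa> (d / 2)"
  have "(pl \<alpha>' b ^^ Suc n) y - (pl \<alpha>' b ^^ Suc n) x = (\<sigma> * \<mu>) * (y - x)"
    if A: "\<alpha> - \<kappa>' \<le> \<alpha>'" "\<alpha>' \<le> \<alpha>" "y - \<eta>' \<le> x" "x \<le> y" for \<alpha>' x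
  proof -
    have diff: "(pl \<alpha>' b ^^ n) y - (pl \<alpha>' b ^^ n) x = \<mu> * (y - x)"
      using A by (intro aff) (auto simp: \<kappa>'_def \<eta>'_def)
    have "\<mu> * (y - x) \<le> \<mu> * (e / (2 * \<mu>))"
      using A pos by (intro mult_left_mono) (auto simp: \<eta>'_def)
    then have small: "\<mu> * (y - x) \<le> e / 2" using pos by simp
    have "\<bar>\<alpha>' - \<alpha>\<bar> < d" using A d(1) by (auto simp: \<kappa>'_def)
    from d(2)[OF this] have near: "(pl \<alpha>' b ^^ n) y > z - e / 2" by linarith
    have "(pl \<alpha>' b ^^ n) y \<le> z" unfolding z_def using A b by (intro pl_iter_mono_param) auto
    moreover have "(pl \<alpha>' b ^^ n) x \<le> (pl \<alpha>' b ^^ n) y" using A b by (intro pl_iter_mono) auto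
    moreover have "z - e \<le> (pl \<alpha>' b ^^ n) x" using diff small near by linarith
    ultimately have "pl \<alpha>' b ((pl \<alpha>' b ^^ n) y) - pl \<alpha>' b ((pl \<alpha>' b ^^ n) x) = \<sigma> * (\<mu> * (y - x))"
      unfolding diff[symmetric] by (intro loc)
    then show ?thesis by simp
  qed
  moreover have "\<eta>' > 0" "\<kappa>' > 0" "\<sigma> * \<mu> > 0" using pos e d by (auto simp: \<eta>'_def \<kappa>'_def)
  ultimately show ?case by (intro exI[of _ \<eta>'] conjI exI[of _ "\<sigma> * \<mu>"] exI[of _ \<kappa>']) auto
qed

text \<open>At the first point \<open>y\<close> of \<open>[u, v]\<close> with \<open>h y \<le> y\<close>, where \<open>h = F\<^sup>s - m\<close>, the graph arrives at the
diagonal from above, so the slope \<open>\<mu>\<close> to the left of \<open>y\<close> is less than 1. The fixed point need not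
attract from the right. Lowering \<open>\<alpha>\<close> a little moves it into the affine piece to the left of \<open>y\<close>,
where it has slope \<open>\<mu>\<close> on both sides.\<close>
lemma trap_imp_near_sinks:
  assumes b: "0 \<le> b" "b < 1" and "trap \<alpha> b"
  shows "near_sinks \<alpha> b"
proof -
  obtain s and m :: int and u v where s: "s > 0" and uv: "u < v" "(pl \<alpha> b ^^ s) u > u + of_int m" "(pl \<alpha> b ^^ s) v \<le> v + of_int m"
    using assms(3) unfolding trap_def by blast
  define h where "h \<beta> x = (pl \<beta> b ^^ s) x - of_int m" for \<beta> x
  have cont: "continuous_on UNIV (h \<beta>)" for \<beta> unfolding h_def by (intro continuous_intros)
  define Z where "Z = {u..v} \<inter> {y. h \<alpha> y \<le> y}"
  have "closed Z" unfolding Z_def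
    by (intro closed_Int closed_atLeastAtMost closed_Collect_le continuous_intros cont)
  moreover have "v \<in> Z" using uv by (auto simp: Z_def h_def)
  moreover have bdd: "bdd_below Z" by (auto simp: Z_def bdd_below_def)
  ultimately have y: "Inf Z \<in> Z" by (intro closed_contains_Inf) auto
  define y where "y = Inf Z"
  have yuv: "u \<le> y" "y \<le> v" and hy: "h \<alpha> y \<le> y" using y by (auto simp: y_def Z_def)
  have "y \<noteq> u" using hy uv(2) by (auto simp: h_def)
  with yuv have uy: "u < y" by simp
  have above: "h \<alpha> x > x" if "u \<le> x" "x < y" for x
  proof (rule ccontr)
    assume "\<not> h \<alpha> x > x"
    with that yuv have "x \<in> Z" by (auto simp: Z_def)
    then have "Inf Z \<le> x" using bdd by (rule cInf_lower)
    with that show False by (simp add: y_def)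
  qed
  obtain \<eta> \<mu> \<kappa> where pos: "\<eta> > 0" "\<mu> > 0" "\<kappa> > 0"
    and aff: "\<And>\<alpha>' x. \<alpha> - \<kappa> \<le> \<alpha>' \<Longrightarrow> \<alpha>' \<le> \<alpha> \<Longrightarrow> y - \<eta> \<le> x \<Longrightarrow> x \<le> y \<Longrightarrow>
       h \<alpha>' y - h \<alpha>' x = \<mu> * (y - x)"
    using pl_iter_left_affine[OF b, of \<alpha> y s] by (auto simp: h_def) 
  define x1 where "x1 = max u (y - \<eta>)"
  have x1: "u \<le> x1" "x1 < y" "y - \<eta> \<le> x1" using uy pos by (auto simp: x1_def)
  have hy_eq: "h \<alpha> y = y"
  proof (rule ccontr)
    assume "h \<alpha> y \<noteq> y"
    with hy have less: "h \<alpha> y < y" by simp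
    have "h \<alpha> (max u (h \<alpha> y)) > max u (h \<alpha> y)" using less uy by (intro above) auto
    moreover have "h \<alpha> (max u (h \<alpha> y)) \<le> h \<alpha> y"
      using less uy b by (auto simp: h_def intro!: pl_iter_mono)
    ultimately show False by simp
  qed
  have "h \<alpha> y - h \<alpha> x1 = \<mu> * (y - x1)" using x1 pos by (intro aff) auto
  with above[of x1] x1 hy_eq have "\<mu> * (y - x1) < 1 * (y - x1)" by argo
  then have l1: "\<mu> < 1" using x1 by simp
  show ?thesis unfolding near_sinks_def
  proof (intro allI impI)
    fix \<epsilon> :: real assume \<epsilon>: "\<epsilon> > 0"
    have "continuous_on UNIV (\<lambda>\<alpha>. h \<alpha> y)" unfolding h_def by (intro continuous_intros)
    then have "isCont (\<lambda>\<alpha>. h \<alpha> y) \<alpha>" by (simp add: continuous_on_eq_continuous_at)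
    moreover have "(1 - \<mu>) * \<eta> > 0" using l1 pos by simp
    ultimately obtain d where d: "d > 0" "\<And>\<alpha>'. \<bar>\<alpha>' - \<alpha>\<bar> < d \<Longrightarrow> \<bar>h \<alpha>' y - y\<bar> < (1 - \<mu>) * \<eta>"
      unfolding continuous_at_eps_delta by (metis dist_real_def hy_eq)
    define \<alpha>' where "\<alpha>' = \<alpha> - min \<kappa> (min (d / 2) (\<epsilon> / 2))"
    have a': "\<alpha> - \<kappa> \<le> \<alpha>'" "\<alpha>' < \<alpha>" "\<bar>\<alpha>' - \<alpha>\<bar> < d" "\<bar>\<alpha>' - \<alpha>\<bar> < \<epsilon>"
      using pos d \<epsilon> by (auto simp: \<alpha>'_def abs_if)
    have below: "h \<alpha>' y < y"
      using pl_iter_speed_param[of b \<alpha>' \<alpha> s y] a' b s hy_eq by (auto simp: h_def)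
    \<comment> \<open>The fixed point of the affine map with slope \<open>\<mu>\<close> through \<open>(y, h \<alpha>' y)\<close>.\<close>
    define x0 where "x0 = y - (y - h \<alpha>' y) / (1 - \<mu>)"
    have "0 < (y - h \<alpha>' y) / (1 - \<mu>)" using below l1 by simp
    moreover have "(y - h \<alpha>' y) / (1 - \<mu>) < \<eta>"
      using d(2)[OF a'(3)] l1 by (simp add: divide_less_eq mult.commute abs_less_iff)
    ultimately have x0: "y - \<eta> < x0" "x0 < y" by (auto simp: x0_def)
    have formula: "h \<alpha>' x - x = (1 - \<mu>) * (x0 - x)" if "y - \<eta> \<le> x" "x \<le> y" for x
    proof -
      have "h \<alpha>' y - h \<alpha>' x = \<mu> * (y - x)" using that a' by (intro aff) auto
      moreover have "(1 - \<mu>) * (x0 - x) = (1 - \<mu>) * (y - x) - (y - h \<alpha>' y)"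
        using l1 by (simp add: x0_def field_simps)
      ultimately show ?thesis by (simp add: algebra_simps)
    qed
    define \<eta>' where "\<eta>' = min (y - x0) (x0 - (y - \<eta>))"
    have \<eta>': "\<eta>' > 0" "\<eta>' \<le> y - x0" "\<eta>' \<le> x0 - (y - \<eta>)" using x0 by (auto simp: \<eta>'_def)
    have "sink \<alpha>' b" unfolding sink_def
    proof (intro exI conjI allI impI)
      show "(pl \<alpha>' b ^^ s) x0 = x0 + of_int m" using formula[of x0] x0 by (simp add: h_def)
    next
      fix x assume x: "x0 < x \<and> x < x0 + \<eta>'"
      then have "(1 - \<mu>) * (x0 - x) < 0" using l1 by (simp add: mult_less_0_iff)
      then show "(pl \<alpha>' b ^^ s) x < x + of_int m" using formula[of x] x \<eta>' x0 by (simp add: h_def)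
    next
      fix x assume x: "x0 - \<eta>' < x \<and> x < x0"
      then have "(1 - \<mu>) * (x0 - x) > 0" using l1 by simp
      then show "(pl \<alpha>' b ^^ s) x > x + of_int m" using formula[of x] x \<eta>' x0 by (simp add: h_def)
    qed (use s \<eta>' in auto)
    with a' b \<epsilon> show "\<exists>\<alpha>' b'. \<bar>\<alpha>' - \<alpha>\<bar> < \<epsilon> \<and> \<bar>b' - b\<bar> < \<epsilon> \<and> 0 \<le> b' \<and> b' < 1 \<and> sink \<alpha>' b'"
      by (intro exI[of _ \<alpha>'] exI[of _ b]) auto
  qed
qed

lemma trap_near_imp_near_sinks:
  assumes "\<And>\<epsilon>. \<epsilon> > 0 \<Longrightarrow> \<exists>\<alpha>' b'. \<bar>\<alpha>' - \<alpha>\<bar> < \<epsilon> \<and> \<bar>b' - b\<bar> < \<epsilon> \<and> 0 \<le> b' \<and> b' < 1 \<and> trap \<alpha>' b'"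
  shows "near_sinks \<alpha> b"
  using assms trap_imp_near_sinks by (intro near_sinks_trans) metis

section \<open>Intervals of periodic points\<close>

lemma pl_iter_close:
  assumes "e > 0"
  shows "\<exists>d>0. \<forall>\<alpha>' b' x. \<bar>\<alpha>' - \<alpha>\<bar> < d \<longrightarrow> \<bar>b' - b\<bar> < d \<longrightarrow> \<bar>x - y\<bar> < d \<longrightarrow>
           \<bar>(pl \<alpha>' b' ^^ n) x - (pl \<alpha> b ^^ n) y\<bar> < e"
proof -
  let ?f = "\<lambda>p::real \<times> real \<times> real. (pl (fst p) (fst (snd p)) ^^ n) (snd (snd p))"
  have "continuous_on UNIV ?f" by (intro continuous_intros)
  then have "isCont ?f (\<alpha>, b, y)" by (simp add: continuous_on_eq_continuous_at)
  then obtain d where d: "d > 0" and close: "\<And>p. dist p (\<alpha>, b, y) < d \<Longrightarrow> dist (?f p) (?f (\<alpha>, b, y)) < e"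
    unfolding continuous_at_eps_delta using assms by blast
  have "dist (\<alpha>', b', x) (\<alpha>, b, y) < d"
    if "\<bar>\<alpha>' - \<alpha>\<bar> < d / 3" "\<bar>b' - b\<bar> < d / 3" "\<bar>x - y\<bar> < d / 3" for \<alpha>' b' x
  proof -
    have "dist (b', x) (b, y) \<le> \<bar>b' - b\<bar> + \<bar>x - y\<bar>"
      using sqrt_sum_squares_le_sum_abs[of "b' - b" "x - y"] by (simp add: dist_Pair_Pair dist_real_def)
    moreover have "dist (\<alpha>', b', x) (\<alpha>, b, y) \<le> \<bar>\<alpha>' - \<alpha>\<bar> + dist (b', x) (b, y)"
      using sqrt_sum_squares_le_sum_abs[of "\<alpha>' - \<alpha>" "dist (b', x) (b, y)"]
      by (subst dist_Pair_Pair) (simp add: dist_real_def)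
    ultimately show ?thesis using that by linarith
  qed
  then show ?thesis
    using close d by (intro exI[of _ "d / 3"]) (fastforce simp: dist_real_def)
qed

lemma pl_affine_near:
  assumes "2 * z \<notin> \<int>"
  obtains e i j where "e > 0" "i + j = (1::nat)"
    "\<And>\<alpha> b x y. \<bar>x - z\<bar> < e \<Longrightarrow> \<bar>y - z\<bar> < e \<Longrightarrow>
       pl \<alpha> b y - pl \<alpha> b x = (2 + 2 * b) ^ i * (2 - 2 * b) ^ j * (y - x)"
proof -
  define k where "k = \<lfloor>2 * z\<rfloor>"
  have "of_int k \<noteq> 2 * z" using assms by (metis Ints_of_int)
  then have k: "of_int k < 2 * z" "2 * z < of_int k + 1"
    unfolding k_def by linarith+
  define e where "e = min (z - of_int k / 2) ((of_int k + 1) / 2 - z)"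
  have e: "e > 0" "e \<le> z - of_int k / 2" "e \<le> (of_int k + 1) / 2 - z" using k by (auto simp: e_def)
  show thesis
  proof (cases "even k")
    case True
    then obtain j where j: "k = 2 * j" by (auto elim: evenE)
    have *: "pl \<alpha> b y - pl \<alpha> b x = (2 + 2 * b) * (y - x)" if "\<bar>x - z\<bar> < e" "\<bar>y - z\<bar> < e" "x \<le> y" for \<alpha> b x y
      using that k e j by (intro pl_expanding[of j]) (auto simp: abs_less_iff field_simps)
    have "pl \<alpha> b y - pl \<alpha> b x = (2 + 2 * b) ^ 1 * (2 - 2 * b) ^ 0 * (y - x)" if "\<bar>x - z\<bar> < e" "\<bar>y - z\<bar> < e" for \<alpha> b x y
      using *[of x y \<alpha> b] *[of y x \<alpha> b] that by (cases "x \<le> y") (auto simp: algebra_simps)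
    with e show thesis by (intro that[of e 1 0]) auto
  next
    case False
    then obtain j where j: "k = 2 * j + 1" by (auto elim: oddE)
    have *: "pl \<alpha> b y - pl \<alpha> b x = (2 - 2 * b) * (y - x)" if "\<bar>x - z\<bar> < e" "\<bar>y - z\<bar> < e" "x \<le> y" for \<alpha> b x y
      using that k e j by (intro pl_contracting[of j]) (auto simp: abs_less_iff field_simps)
    have "pl \<alpha> b y - pl \<alpha> b x = (2 + 2 * b) ^ 0 * (2 - 2 * b) ^ 1 * (y - x)" if "\<bar>x - z\<bar> < e" "\<bar>y - z\<bar> < e" for \<alpha> b x y
      using *[of x y \<alpha> b] *[of y x \<alpha> b] that by (cases "x \<le> y") (auto simp: algebra_simps)
    with e show thesis by (intro that[of e 0 1]) auto
  qed
qed

lemma pl_iter_affine_near: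
  assumes "\<And>l. l < n \<Longrightarrow> 2 * (pl \<alpha> b ^^ l) y \<notin> \<int>"
  shows "\<exists>i j. i + j = n \<and> (\<exists>\<eta>>0. \<forall>\<alpha>' b' x. \<bar>\<alpha>' - \<alpha>\<bar> < \<eta> \<longrightarrow> \<bar>b' - b\<bar> < \<eta> \<longrightarrow> \<bar>x - y\<bar> < \<eta> \<longrightarrow>
           (pl \<alpha>' b' ^^ n) x - (pl \<alpha>' b' ^^ n) y = (2 + 2 * b') ^ i * (2 - 2 * b') ^ j * (x - y))"
  using assms
proof (induct n)
  case 0
  show ?case by (rule exI[of _ 0], rule exI[of _ 0], simp, rule exI[of _ 1], simp)
next
  case (Suc n)
  then obtain i j \<eta> where ij: "i + j = n" and \<eta>: "\<eta> > 0"
    and aff: "\<And>\<alpha>' b' x. \<bar>\<alpha>' - \<alpha>\<bar> < \<eta> \<Longrightarrow> \<bar>b' - b\<bar> < \<eta> \<Longrightarrow> \<bar>x - y\<bar> < \<eta> \<Longrightarrow>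
       (pl \<alpha>' b' ^^ n) x - (pl \<alpha>' b' ^^ n) y = (2 + 2 * b') ^ i * (2 - 2 * b') ^ j * (x - y)"
    by (metis less_Suc_eq)
  define z where "z = (pl \<alpha> b ^^ n) y"
  have "2 * z \<notin> \<int>" using Suc.prems[of n] by (simp add: z_def)
  then obtain e i' j' where e: "e > 0" "i' + j' = (1::nat)"
    and loc: "\<And>\<alpha> b x y. \<bar>x - z\<bar> < e \<Longrightarrow> \<bar>y - z\<bar> < e \<Longrightarrow>
       pl \<alpha> b y - pl \<alpha> b x = (2 + 2 * b) ^ i' * (2 - 2 * b) ^ j' * (y - x)"
    using pl_affine_near by metis
  obtain d where d: "d > 0" and close: "\<And>\<alpha>' b' x. \<bar>\<alpha>' - \<alpha>\<bar> < d \<Longrightarrow> \<bar>b' - b\<bar> < d \<Longrightarrow> \<bar>x - y\<bar> < d \<Longrightarrow>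
           \<bar>(pl \<alpha>' b' ^^ n) x - z\<bar> < e"
    using pl_iter_close[OF e(1), of \<alpha> b y n] unfolding z_def by auto
  have "(pl \<alpha>' b' ^^ Suc n) x - (pl \<alpha>' b' ^^ Suc n) y = (2 + 2 * b') ^ (i + i') * (2 - 2 * b') ^ (j + j') * (x - y)"
    if A: "\<bar>\<alpha>' - \<alpha>\<bar> < min \<eta> d" "\<bar>b' - b\<bar> < min \<eta> d" "\<bar>x - y\<bar> < min \<eta> d" for \<alpha>' b' x
  proof -
    have "(pl \<alpha>' b' ^^ Suc n) x - (pl \<alpha>' b' ^^ Suc n) y
        = (2 + 2 * b') ^ i' * (2 - 2 * b') ^ j' * ((pl \<alpha>' b' ^^ n) x - (pl \<alpha>' b' ^^ n) y)"
      using loc[OF close[of \<alpha>' b' y] close[of \<alpha>' b' x], of \<alpha>' b'] A d by simp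
    also have "(pl \<alpha>' b' ^^ n) x - (pl \<alpha>' b' ^^ n) y = (2 + 2 * b') ^ i * (2 - 2 * b') ^ j * (x - y)"
      using A by (intro aff) auto
    finally show ?thesis by (simp add: power_add algebra_simps)
  qed
  moreover have "min \<eta> d > 0" "(i + i') + (j + j') = Suc n" using \<eta> d ij e by auto
  ultimately show ?case by blast
qed

text \<open>The logarithm of \<open>(2 + 2 b)\<^sup>i (2 - 2 b)\<^sup>j\<close> is concave in \<open>b\<close> and positive at \<open>b = 0\<close>, so it is
negative beyond any zero.\<close>
lemma multiplier_decreases:
  fixes b b' :: real
  assumes b: "0 < b" "b < b'" "b' < 1" and "i + j > 0"
    and one: "(2 + 2 * b) ^ i * (2 - 2 * b) ^ j = 1"
  shows "(2 + 2 * b') ^ i * (2 - 2 * b') ^ j < 1"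
proof -
  define t where "t = b / b'"
  have t: "0 < t" "t < 1" "b = t * b'" using b by (auto simp: t_def)
  have conc: "t * ln (1 + c * b') \<le> ln (1 + c * b)" if "0 < 1 + c * b'" for c
  proof -
    have "t * ln (1 + c * b') \<le> ln (t * (1 + c * b') + (1 - t) * 1)"
      using concave_onD[OF ln_concave, of "1 - t" "1 + c * b'" 1] that t by simp
    also have "t * (1 + c * b') + (1 - t) * 1 = 1 + c * b" using t(3) by (simp add: algebra_simps)
    finally show ?thesis .
  qed
  define L where "L x = real (i + j) * ln 2 + real i * ln (1 + 1 * x) + real j * ln (1 + - 1 * x)" for x
  have L: "L x = ln ((2 + 2 * x) ^ i * (2 - 2 * x) ^ j)" if "0 < x" "x < 1" for x
  proof -
    have "ln (2 + 2 * x) = ln 2 + ln (1 + x)" "ln (2 - 2 * x) = ln 2 + ln (1 - x)"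
      using that ln_mult[of 2 "1 + x"] ln_mult[of 2 "1 - x"] by (simp_all add: algebra_simps)
    then show ?thesis using that by (simp add: L_def ln_mult ln_realpow algebra_simps)
  qed
  have "L b = 0" using L[of b] b one by simp
  have "real i * (t * ln (1 + 1 * b')) \<le> real i * ln (1 + 1 * b)"
    "real j * (t * ln (1 + - 1 * b')) \<le> real j * ln (1 + - 1 * b)"
    using b by (intro mult_left_mono conc; simp)+
  then have "t * L b' + (1 - t) * (real (i + j) * ln 2) \<le> L b"
    unfolding L_def by (simp add: algebra_simps)
  moreover have "(1 - t) * (real (i + j) * ln 2) > 0"
    using t assms(4) by (intro mult_pos_pos) (auto simp del: of_nat_add)
  ultimately have "t * L b' < 0" using \<open>L b = 0\<close> by linarith
  then have "L b' < 0" using t by (simp add: mult_less_0_iff)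
  then show ?thesis using L[of b'] b by (simp add: ln_less_zero_iff)
qed

text \<open>On an interval of fixed points the slope \<open>(2 + 2 b)\<^sup>i (2 - 2 b)\<^sup>j\<close> of \<open>F\<^sup>s\<close> is 1. Around a point
whose orbit avoids the turning points the numbers \<open>i\<close> and \<open>j\<close> persist under perturbation, so a
larger \<open>b\<close> makes the slope less than 1, and a small change of \<open>\<alpha>\<close> makes the point fixed again.\<close>
lemma periodic_interval_imp_near_sinks:
  assumes b: "0 \<le> b" "b < 1" and s: "s > 0" and pq: "p < q"
    and id: "\<And>x. p \<le> x \<Longrightarrow> x \<le> q \<Longrightarrow> (pl \<alpha> b ^^ s) x = x + of_int m"
  shows "near_sinks \<alpha> b"
proof -
  have "countable {x. 2 * (pl \<alpha> b ^^ l) x \<in> \<int>}" for l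
  proof (rule countable_image_inj_on)
    show "countable ((\<lambda>x. 2 * (pl \<alpha> b ^^ l) x) ` {x. 2 * (pl \<alpha> b ^^ l) x \<in> \<int>})"
      by (rule countable_subset[OF _ countable_int]) auto
    show "inj_on (\<lambda>x. 2 * (pl \<alpha> b ^^ l) x) {x. 2 * (pl \<alpha> b ^^ l) x \<in> \<int>}"
      by (rule inj_onI) (metis pl_iter_less_iff[OF b] linorder_neqE_linordered_idom less_irrefl mult_left_cancel zero_neq_numeral)
  qed
  then have "countable (\<Union>l. {x. 2 * (pl \<alpha> b ^^ l) x \<in> \<int>})" by simp
  moreover have "uncountable {p<..<q}" using pq by (simp add: uncountable_open_interval)
  ultimately have "\<not> {p<..<q} \<subseteq> (\<Union>l. {x. 2 * (pl \<alpha> b ^^ l) x \<in> \<int>})"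
    using countable_subset by blast
  then obtain y where y: "p < y" "y < q" and ny: "2 * (pl \<alpha> b ^^ l) y \<notin> \<int>" for l
    by (auto simp: subset_iff)
  obtain i j \<eta> where ij: "i + j = s" and \<eta>: "\<eta> > 0"
    and aff: "\<And>\<alpha>' b' x. \<bar>\<alpha>' - \<alpha>\<bar> < \<eta> \<Longrightarrow> \<bar>b' - b\<bar> < \<eta> \<Longrightarrow> \<bar>x - y\<bar> < \<eta> \<Longrightarrow>
       (pl \<alpha>' b' ^^ s) x - (pl \<alpha>' b' ^^ s) y = (2 + 2 * b') ^ i * (2 - 2 * b') ^ j * (x - y)"
    using pl_iter_affine_near[of s \<alpha> b y] ny by blast
  define x where "x = min (y + \<eta> / 2) q"
  have x: "y < x" "x \<le> q" "\<bar>x - y\<bar> < \<eta>" using y \<eta> by (auto simp: x_def)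
  have "(2 + 2 * b) ^ i * (2 - 2 * b) ^ j * (x - y) = x - y"
    using aff[of \<alpha> b x] \<eta> x y id[of x] id[of y] by simp
  then have one: "(2 + 2 * b) ^ i * (2 - 2 * b) ^ j = 1" using x by simp
  have b0: "b > 0"
  proof (rule ccontr)
    assume "\<not> b > 0"
    then have "(2::real) ^ s = 1" using b one ij by (simp flip: power_add)
    with s show False by (metis less_numeral_extra(4) one_less_numeral_iff one_less_power semiring_norm(76))
  qed
  show ?thesis unfolding near_sinks_def
  proof (intro allI impI)
    fix \<epsilon> :: real assume "\<epsilon> > 0"
    define e where "e = min \<epsilon> \<eta> / 2"
    have e: "e > 0" "e < \<epsilon>" "e < \<eta>" using \<open>\<epsilon> > 0\<close> \<eta> by (auto simp: e_def)
    obtain d where d: "d > 0" and close: "\<And>\<alpha>' b' x. \<bar>\<alpha>' - \<alpha>\<bar> < d \<Longrightarrow> \<bar>b' - b\<bar> < d \<Longrightarrow> \<bar>x - y\<bar> < d \<Longrightarrow>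
           \<bar>(pl \<alpha>' b' ^^ s) x - (pl \<alpha> b ^^ s) y\<bar> < e"
      using pl_iter_close[OF e(1), of \<alpha> b y s] by auto
    define b' where "b' = b + min (min (d / 2) e) ((1 - b) / 2)"
    have b': "b < b'" "b' < 1" "\<bar>b' - b\<bar> < d" "\<bar>b' - b\<bar> \<le> e"
      using d e b by (auto simp: b'_def abs_if min_def field_simps)
    define \<mu> where "\<mu> = (2 + 2 * b') ^ i * (2 - 2 * b') ^ j"
    have "\<mu> < 1" unfolding \<mu>_def
      by (rule multiplier_decreases[OF b0 b'(1,2) _ one]) (use s ij in simp)
    have hy: "\<bar>(pl \<alpha> b' ^^ s) y - (y + of_int m)\<bar> < e"
      using close[of \<alpha> b' y] d b' id[of y] y by simp
    have up: "(pl (\<alpha> + e) b' ^^ s) y \<ge> y + of_int m"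
      using pl_iter_speed_param[of b' \<alpha> "\<alpha> + e" s y] b' b e s hy by simp
    have dn: "(pl (\<alpha> - e) b' ^^ s) y \<le> y + of_int m"
      using pl_iter_speed_param[of b' "\<alpha> - e" \<alpha> s y] b' b e s hy by simp
    have "\<exists>\<alpha>'\<ge>\<alpha> - e. \<alpha>' \<le> \<alpha> + e \<and> (pl \<alpha>' b' ^^ s) y = y + of_int m"
      by (rule IVT') (use up dn e in \<open>auto intro!: continuous_intros\<close>)
    then obtain \<alpha>' where "\<alpha> - e \<le> \<alpha>'" "\<alpha>' \<le> \<alpha> + e" and hm: "(pl \<alpha>' b' ^^ s) y = y + of_int m"
      by auto
    then have a': "\<bar>\<alpha>' - \<alpha>\<bar> \<le> e" "(pl \<alpha>' b' ^^ s) y = y + of_int m" by auto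
    have form: "(pl \<alpha>' b' ^^ s) x - (x + of_int m) = (\<mu> - 1) * (x - y)" if "\<bar>x - y\<bar> < \<eta>" for x
      using aff[of \<alpha>' b' x] a' b' e that by (simp add: \<mu>_def algebra_simps)
    have "sink \<alpha>' b'" unfolding sink_def
    proof (intro exI conjI allI impI)
      fix x assume x: "y < x \<and> x < y + \<eta>"
      then have "(\<mu> - 1) * (x - y) < 0" using \<open>\<mu> < 1\<close> by (simp add: mult_less_0_iff)
      then show "(pl \<alpha>' b' ^^ s) x < x + of_int m" using form[of x] x by simp
    next
      fix x assume x: "y - \<eta> < x \<and> x < y"
      then have "(\<mu> - 1) * (x - y) > 0" using \<open>\<mu> < 1\<close> by (simp add: zero_less_mult_iff)
      then show "(pl \<alpha>' b' ^^ s) x > x + of_int m" using form[of x] x by simp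
    qed (use s \<eta> a' in auto)
    then show "\<exists>\<alpha>' b'. \<bar>\<alpha>' - \<alpha>\<bar> < \<epsilon> \<and> \<bar>b' - b\<bar> < \<epsilon> \<and> 0 \<le> b' \<and> b' < 1 \<and> sink \<alpha>' b'"
      using a' b' b e by (intro exI[of _ \<alpha>'] exI[of _ b']) auto
  qed
qed

section \<open>The flat case\<close>

text \<open>For \<open>b = 1\<close> the map is constant on \<open>[1/2, 1]\<close>, so a return of this value to the open
interval gives a trap, which persists for \<open>b < 1\<close>. Some \<open>\<beta>\<close> near \<open>\<alpha>\<close> has such a return: otherwise
the orbit of \<open>3/4\<close>, for all these \<open>\<beta>\<close> simultaneously, would stay in pieces of slope 4 after the
first step, and its dependence on \<open>\<beta>\<close> would expand by the factor 4 forever while being confined to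
an interval of length \<open>1/2\<close>.\<close>
lemma flat_piece_imp_near_sinks: "near_sinks \<alpha> 1"
proof (rule trap_near_imp_near_sinks)
  fix \<epsilon> :: real assume \<epsilon>: "\<epsilon> > 0"
  define c where "c s \<beta> = (pl \<beta> 1 ^^ s) (3/4)" for s \<beta>
  have cmono: "c s \<beta> \<le> c s \<gamma>" if "\<beta> \<le> \<gamma>" for s \<beta> \<gamma>
    unfolding c_def using that by (intro pl_iter_mono_param) auto
  have ccont: "continuous_on S (c s)" for S s
    unfolding c_def by (intro continuous_intros)
  have "\<exists>\<beta>. \<bar>\<beta> - \<alpha>\<bar> < \<epsilon> \<and> (\<exists>s>0. \<exists>k::int. of_int k + 1/2 < c s \<beta> \<and> c s \<beta> < of_int k + 1)"
  proof (rule ccontr)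
    assume "\<not> ?thesis"
    then have no: "\<not> (of_int k + 1/2 < c s \<beta> \<and> c s \<beta> < of_int k + 1)" if "\<bar>\<beta> - \<alpha>\<bar> < \<epsilon>" "s > 0" for \<beta> s and k :: int
      using that by blast
    define \<beta> where "\<beta> = \<alpha> + \<epsilon> / 2"
    have same: "\<exists>k::int. of_int k \<le> c s \<alpha> \<and> c s \<alpha> \<le> c s \<beta> \<and> c s \<beta> \<le> of_int k + 1/2" if "s > 0" for s
    proof (intro exI conjI)
      let ?k = "\<lfloor>c s \<alpha>\<rfloor>"
      show "of_int ?k \<le> c s \<alpha>" by simp
      show "c s \<alpha> \<le> c s \<beta>" using \<epsilon> by (intro cmono) (simp add: \<beta>_def)
      have "c s \<alpha> < of_int ?k + 1" by linarith
      with no[of \<alpha> s ?k] \<epsilon> that have lo: "c s \<alpha> \<le> of_int ?k + 1/2" by auto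
      show "c s \<beta> \<le> of_int ?k + 1/2"
      proof (rule ccontr)
        assume "\<not> c s \<beta> \<le> of_int ?k + 1/2"
        define w where "w = min (c s \<beta>) (of_int ?k + 3/4)"
        have w: "of_int ?k + 1/2 < w" "w < of_int ?k + 1" "w \<le> c s \<beta>"
          using \<open>\<not> c s \<beta> \<le> of_int ?k + 1/2\<close> by (auto simp: w_def)
        have "\<exists>\<gamma>\<ge>\<alpha>. \<gamma> \<le> \<beta> \<and> c s \<gamma> = w"
          by (rule IVT') (use w lo \<epsilon> ccont in \<open>auto simp: \<beta>_def\<close>)
        then obtain \<gamma> where "\<alpha> \<le> \<gamma>" "\<gamma> \<le> \<beta>" "c s \<gamma> = w" by auto
        with no[of \<gamma> s ?k] w \<epsilon> that show False by (auto simp: \<beta>_def abs_if)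
      qed
    qed
    have grow: "c (Suc n) \<beta> - c (Suc n) \<alpha> \<ge> 4 ^ n * (\<beta> - \<alpha>)" for n
    proof (induct n)
      case 0 then show ?case by (simp add: c_def pl_def)
    next
      case (Suc n)
      obtain k :: int where k: "of_int k \<le> c (Suc n) \<alpha>" "c (Suc n) \<alpha> \<le> c (Suc n) \<beta>" "c (Suc n) \<beta> \<le> of_int k + 1/2"
        using same[of "Suc n"] by auto
      have "c (Suc (Suc n)) \<beta> - c (Suc (Suc n)) \<alpha> = (\<beta> - \<alpha>) + (pl \<alpha> 1 (c (Suc n) \<beta>) - pl \<alpha> 1 (c (Suc n) \<alpha>))"
        by (simp add: c_def pl_def)
      also have "\<dots> = (\<beta> - \<alpha>) + 4 * (c (Suc n) \<beta> - c (Suc n) \<alpha>)"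
        using pl_expanding[OF k] by simp
      also have "\<dots> \<ge> 4 ^ Suc n * (\<beta> - \<alpha>)" using Suc \<epsilon> by (simp add: \<beta>_def algebra_simps)
      finally show ?case .
    qed
    obtain n where "1 / (\<beta> - \<alpha>) < 4 ^ n" using real_arch_pow[of 4] by auto
    then have "1 < 4 ^ n * (\<beta> - \<alpha>)" using \<epsilon> by (simp add: \<beta>_def field_simps)
    with grow[of n] same[of "Suc n"] show False by force
  qed
  then obtain \<beta> s and k :: int where \<beta>: "\<bar>\<beta> - \<alpha>\<bar> < \<epsilon>" and s: "s > 0"
    and k: "of_int k + 1/2 < c s \<beta>" "c s \<beta> < of_int k + 1" by blast
  define w where "w = c s \<beta> - of_int k"
  have w: "1/2 < w" "w < 1" using k by (auto simp: w_def)
  define u v where "u = (1/2 + w) / 2" and "v = (w + 1) / 2"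
  have uv: "1/2 < u" "u < w" "w < v" "v < 1" using w by (auto simp: u_def v_def)
  obtain s' where s': "s = Suc s'" using s by (cases s) auto
  have flat: "(pl \<beta> 1 ^^ s) x = w + of_int k" if "1/2 \<le> x" "x \<le> 1" for x
  proof -
    have "pl \<beta> 1 x = pl \<beta> 1 (1/2)" "pl \<beta> 1 (3/4) = pl \<beta> 1 (1/2)"
      using pl_contracting[of 0 "1/2" x \<beta> 1] pl_contracting[of 0 "1/2" "3/4" \<beta> 1] that by auto
    then have "(pl \<beta> 1 ^^ s) x = c s \<beta>" unfolding s' c_def by (simp add: funpow_swap1)
    then show ?thesis by (simp add: w_def)
  qed
  obtain d1 where d1: "d1 > 0" "\<And>b'. \<bar>b' - 1\<bar> < d1 \<Longrightarrow> \<bar>(pl \<beta> b' ^^ s) u - (pl \<beta> 1 ^^ s) u\<bar> < w - u"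
    using pl_iter_close[of "w - u" \<beta> 1 u s] uv by auto
  obtain d2 where d2: "d2 > 0" "\<And>b'. \<bar>b' - 1\<bar> < d2 \<Longrightarrow> \<bar>(pl \<beta> b' ^^ s) v - (pl \<beta> 1 ^^ s) v\<bar> < v - w"
    using pl_iter_close[of "v - w" \<beta> 1 v s] uv by auto
  define b' where "b' = 1 - min (min d1 d2) (min \<epsilon> 1) / 2"
  have b': "0 \<le> b'" "b' < 1" "\<bar>b' - 1\<bar> < d1" "\<bar>b' - 1\<bar> < d2" "\<bar>b' - 1\<bar> < \<epsilon>"
    using d1(1) d2(1) \<epsilon> by (auto simp: b'_def)
  have "trap \<beta> b'" unfolding trap_def
    using s uv d1(2)[OF b'(3)] d2(2)[OF b'(4)] flat[of u] flat[of v]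
    by (intro exI[of _ s] conjI exI[of _ k] exI[of _ u] exI[of _ v]) (auto simp: abs_less_iff)
  with \<beta> b' show "\<exists>\<alpha>' b'. \<bar>\<alpha>' - \<alpha>\<bar> < \<epsilon> \<and> \<bar>b' - 1\<bar> < \<epsilon> \<and> 0 \<le> b' \<and> b' < 1 \<and> trap \<alpha>' b'"
    by blast
qed

section \<open>Wandering intervals\<close>

text \<open>Let \<open>J\<^sub>i\<close> be the interval with end points \<open>F\<^sup>i L\<close> and \<open>r i = F\<^sup>i R\<close>, of length \<open>D i\<close>. It lies in one
affine piece of \<open>F\<close>, and \<open>con i\<close> says that this is a piece of slope \<open>2 - 2 b\<close>, whose right end is then the
integer \<open>P i\<close>.

An interval adjacent to \<open>J\<^sub>i\<close> on the right is expanded at most as much as \<open>J\<^sub>i\<close> itself, unless \<open>con i\<close>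
holds and it reaches over \<open>P i\<close> (\<open>step\<close>). Hence \<open>[R, R + \<delta>]\<close> would stay comparable to \<open>J\<^sub>i\<close> forever,
against \<open>escape\<close>, if no image of it did so. Let \<open>\<tau> i\<close> be the number with \<open>F\<^sup>i (R + \<tau> i) = P i\<close>. It
follows that \<open>\<tau>\<close> takes arbitrarily small values at times with \<open>con\<close>. Let \<open>n < m\<close> be consecutive
records, that is, times with \<open>con\<close> at which \<open>\<tau>\<close> is smaller than at all earlier times with \<open>con\<close>, and
let \<open>s = m - n\<close>.

Before time \<open>m\<close> no image of the gap \<open>[r n, P n]\<close> reaches over the point \<open>P\<close> of a time with \<open>con\<close>, so
the image at time \<open>m\<close> is short, while \<open>F\<^sup>s (P n) > P m\<close>. A small decrease of \<open>\<alpha>\<close> to some \<open>\<beta>\<close> therefore makes \<open>P n\<close> return exactly to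
\<open>P m\<close>. In the course of this decrease the images of \<open>P n\<close> move to the left, hence not over these points, but
they remain to the right of the intervals \<open>J\<^sub>i\<close>: otherwise \<open>P n\<close> would end to the left of \<open>r m < P m\<close>. So the slope of
\<open>F\<^sup>s\<close> to the left of \<open>P n\<close> is still at most \<open>D m / D n\<close>. As the lengths tend to 0, there are
consecutive records with \<open>D m < D n\<close>, and then \<open>P n\<close> is the right end of a trap.

The turning points \<open>k + 1/2\<close> are harmless for these estimates because the slope to the right of
such a point is smaller than the slope to its left.\<close>
lemma wandering_interval_imp_near_sinks:
  assumes b: "0 \<le> b" "b < 1" and LR: "L < R"
    and avoid: "\<And>i k::int. \<not> ((pl \<alpha> b ^^ i) L \<le> of_int k / 2 \<and> of_int k / 2 \<le> (pl \<alpha> b ^^ i) R)"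
    and shrink: "(\<lambda>i. (pl \<alpha> b ^^ i) R - (pl \<alpha> b ^^ i) L) \<longlonglongrightarrow> 0"
    and escape: "\<And>\<delta> B. \<delta> > 0 \<Longrightarrow> \<exists>i. (pl \<alpha> b ^^ i) (R + \<delta>) - (pl \<alpha> b ^^ i) R > B"
  shows "near_sinks \<alpha> b"
proof (rule trap_near_imp_near_sinks)
  fix \<epsilon> :: real assume \<epsilon>: "\<epsilon> > 0"
  define r where "r i = (pl \<alpha> b ^^ i) R" for i
  define D where "D i = (pl \<alpha> b ^^ i) R - (pl \<alpha> b ^^ i) L" for i
  define P where "P i = \<lfloor>r i\<rfloor> + 1" for i
  define con where "con i \<longleftrightarrow> of_int (P i) - 1/2 < r i" for i
  have D_pos: "D i > 0" for i
    using pl_iter_strict_mono[OF b LR, where \<alpha> = \<alpha> and n = i] by (simp add: D_def)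
  have rP: "r i < of_int (P i)" for i unfolding P_def by linarith
  have floor_r: "of_int (P i) - 1 \<le> r i" for i unfolding P_def by linarith
  have l_con: "of_int (P i) - 1/2 < r i - D i" if "con i" for i
    using avoid[of i "2 * P i - 1"] that by (auto simp: con_def r_def D_def field_simps)
  have l_exp: "of_int (P i) - 1 < r i - D i" for i
    using avoid[of i "2 * P i - 2"] floor_r[of i] by (auto simp: r_def D_def field_simps)
  have r_Suc: "r (Suc i) = pl \<alpha> b (r i)" "r (Suc i) - D (Suc i) = pl \<alpha> b (r i - D i)" for i
    by (simp_all add: r_def D_def)
  have D_con: "D (Suc i) = (2 - 2 * b) * D i" if "con i" for i
    using pl_contracting[of "P i - 1" "r i - D i" "r i" \<alpha> b] l_con[OF that] rP[of i] D_pos[of i] r_Suc[of i] by simp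
  have D_exp: "D (Suc i) = (2 + 2 * b) * D i" if "\<not> con i" for i
    using pl_expanding[of "P i - 1" "r i - D i" "r i" \<alpha> b] l_exp[of i] that D_pos[of i] r_Suc[of i] by (simp add: con_def)
  \<comment> \<open>The factor \<open>D (Suc i) / D i\<close> is the slope of the piece that contains \<open>J\<^sub>i\<close>; the parameter
    \<open>\<beta>\<close> is free since slopes do not depend on it.\<close>
  have step: "pl \<beta> b y - pl \<beta> b x \<le> q * D (Suc i)"
    if "x \<le> y" "con i \<Longrightarrow> of_int (P i) - 1/2 \<le> x \<and> y \<le> of_int (P i)" "y - x \<le> q * D i" for \<beta> x y q i
  proof (cases "con i")
    case True
    have "pl \<beta> b y - pl \<beta> b x = (2 - 2 * b) * (y - x)"
      using that True by (intro pl_contracting[of "P i - 1"]) auto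
    also have "\<dots> \<le> (2 - 2 * b) * (q * D i)" using that b by (intro mult_left_mono) auto
    finally show ?thesis by (simp only: D_con[OF True] mult.left_commute)
  next
    case False
    have "pl \<beta> b y - pl \<beta> b x \<le> (2 + 2 * b) * (y - x)" using that b by (intro pl_upper) auto
    also have "\<dots> \<le> (2 + 2 * b) * (q * D i)" using that b by (intro mult_left_mono) auto
    finally show ?thesis by (simp only: D_exp[OF False] mult.left_commute)
  qed
  have ext: "(pl \<alpha> b ^^ n) (R + \<delta>) - r n \<le> \<delta> / D 0 * D n"
    if "\<delta> > 0" "\<And>i. i < n \<Longrightarrow> con i \<Longrightarrow> (pl \<alpha> b ^^ i) (R + \<delta>) \<le> of_int (P i)" for n \<delta>
    using that(2)
  proof (induct n)
    case 0
    show ?case using D_pos[of 0] by (simp add: r_def)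
  next
    case (Suc n)
    have "r n \<le> (pl \<alpha> b ^^ n) (R + \<delta>)" unfolding r_def using that(1) b by (intro pl_iter_mono) auto
    then have "pl \<alpha> b ((pl \<alpha> b ^^ n) (R + \<delta>)) - pl \<alpha> b (r n) \<le> \<delta> / D 0 * D (Suc n)"
      using Suc by (intro step) (auto simp: con_def)
    then show ?case by (simp add: r_Suc)
  qed
  have "\<exists>t>0. (pl \<alpha> b ^^ i) (R + t) = of_int (P i)" for i
  proof -
    have "(pl \<alpha> b ^^ i) (R + 1) = r i + 2 ^ i" using pl_iter_add_int[where \<alpha> = \<alpha> and b = b and n = i and x = R and k = 1] by (simp add: r_def)
    moreover have "(1::real) \<le> 2 ^ i" by simp
    ultimately have "of_int (P i) \<le> (pl \<alpha> b ^^ i) (R + 1)" using floor_r[of i] by linarith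
    then have "\<exists>t\<ge>0. t \<le> 1 \<and> (pl \<alpha> b ^^ i) (R + t) = of_int (P i)"
      using rP[of i] by (intro IVT') (auto simp: r_def intro!: continuous_intros)
    then obtain t where "t \<ge> 0" "(pl \<alpha> b ^^ i) (R + t) = of_int (P i)" by auto
    moreover have "t \<noteq> 0" using calculation rP[of i] by (auto simp: r_def)
    ultimately show ?thesis by (intro exI[of _ t]) auto
  qed
  then obtain \<tau> where \<tau>: "\<And>i. \<tau> i > 0" "\<And>i. (pl \<alpha> b ^^ i) (R + \<tau> i) = of_int (P i)" by metis
  have le_P: "(pl \<alpha> b ^^ i) (R + \<delta>) \<le> of_int (P i) \<longleftrightarrow> \<delta> \<le> \<tau> i" for i \<delta>
    using pl_iter_less_iff[OF b, where \<alpha> = \<alpha> and n = i and x = "R + \<tau> i" and y = "R + \<delta>"] by (simp add: \<tau> flip: not_less)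
  have hit: "\<exists>i. con i \<and> \<tau> i < \<delta>" if "\<delta> > 0" for \<delta>
  proof (rule ccontr)
    assume "\<not> ?thesis"
    then have "(pl \<alpha> b ^^ n) (R + \<delta>) - r n \<le> \<delta> / D 0 * D n" for n
      using that by (intro ext) (auto simp: le_P not_less)
    moreover have "Bseq D" using shrink unfolding D_def by (intro convergent_imp_Bseq convergentI)
    then obtain K where "\<And>n. norm (D n) \<le> K" by (meson BseqE)
    then have "\<delta> / D 0 * D n \<le> \<delta> / D 0 * K" for n
      using that D_pos[of 0] by (intro mult_left_mono) (auto simp: abs_le_iff)
    ultimately have "(pl \<alpha> b ^^ n) (R + \<delta>) - r n \<le> \<delta> / D 0 * K" for n by (meson order_trans)
    with escape[OF that, of "\<delta> / D 0 * K"] show False by (auto simp: r_def not_less[symmetric])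
  qed
  \<comment> \<open>The least \<open>m\<close> is a record time following \<open>n\<close> when \<open>n\<close> is a record time.\<close>
  define nxt where "nxt n = (LEAST m. con m \<and> \<tau> m < \<tau> n)" for n
  have nxt: "con (nxt n) \<and> \<tau> (nxt n) < \<tau> n" for n
    unfolding nxt_def using hit[OF \<tau>(1)[of n]] by (rule LeastI_ex)
  have nxt_least: "\<tau> n \<le> \<tau> i" if "i < nxt n" "con i" for i n
    using not_less_Least[of i "\<lambda>m. con m \<and> \<tau> m < \<tau> n"] that unfolding nxt_def by (metis not_less)
  define n0 where "n0 = (LEAST m. con m)"
  have "\<exists>m. con m" using hit[of 1] by auto
  then have "con n0" unfolding n0_def by (rule LeastI_ex)
  have n0_least: "\<not> con i" if "i < n0" for i using not_less_Least[of i con] that by (simp add: n0_def)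
  define rec where "rec k = (nxt ^^ k) n0" for k
  have rec_con: "con (rec k)" for k using \<open>con n0\<close> nxt by (cases k) (auto simp: rec_def)
  have rec_Suc: "rec (Suc k) = nxt (rec k)" for k by (simp add: rec_def)
  have rec_min: "\<tau> (rec k) \<le> \<tau> i" if "i \<le> rec k" "con i" for i k
  proof (cases k)
    case 0
    then have "i = n0" using that n0_least[of i] by (auto simp: rec_def order_le_less)
    then show ?thesis using 0 by (simp add: rec_def)
  next
    case (Suc k')
    show ?thesis
    proof (cases "i = rec k")
      case False
      then have "\<tau> (rec k') \<le> \<tau> i" using that Suc rec_Suc nxt_least[of i "rec k'"] by simp
      then show ?thesis using nxt[of "rec k'"] Suc rec_Suc by simp
    qed simp
  qed
  have rec_less: "rec k < rec (Suc k)" for k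
    using rec_min[of "rec (Suc k)" k] rec_con[of "Suc k"] nxt[of "rec k"] rec_Suc[of k] by force
  then have mono_rec: "strict_mono rec" by (simp add: strict_mono_Suc_iff)
  have \<tau>_rec: "\<tau> (rec k) \<le> \<tau> n0" for k
  proof (induct k)
    case (Suc k) then show ?case using nxt[of "rec k"] by (simp add: rec_Suc)
  qed (simp add: rec_def)
  have "D \<longlonglongrightarrow> 0" using shrink by (simp add: D_def[abs_def])
  moreover have "\<epsilon> * D 0 / \<tau> n0 > 0" using \<epsilon> D_pos \<tau>(1) by simp
  ultimately have "\<forall>\<^sub>F i in sequentially. D i < \<epsilon> * D 0 / \<tau> n0" by (rule order_tendstoD)
  then obtain K where K: "\<And>i. i \<ge> K \<Longrightarrow> D i < \<epsilon> * D 0 / \<tau> n0"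
    by (auto simp: eventually_sequentially)
  have "\<exists>k\<ge>K. D (rec (Suc k)) < D (rec k)"
  proof (rule ccontr)
    assume "\<not> ?thesis"
    then have "incseq (\<lambda>k. D (rec (K + k)))" unfolding incseq_Suc_iff by (auto simp: not_less)
    moreover have "(\<lambda>k. D (rec (K + k))) \<longlonglongrightarrow> 0"
      using LIMSEQ_subseq_LIMSEQ[OF \<open>D \<longlonglongrightarrow> 0\<close>, of "\<lambda>k. rec (K + k)"] mono_rec
      by (simp add: o_def strict_mono_def)
    ultimately have "D (rec (K + 0)) \<le> 0" by (rule incseq_le)
    with D_pos show False by (simp add: not_le[symmetric])
  qed
  then obtain k where k: "k \<ge> K" "D (rec (Suc k)) < D (rec k)" by auto
  \<comment> \<open>\<open>D m < D n\<close> is the required contraction; \<open>k \<ge> K\<close> makes the parameter change less than \<open>\<epsilon>\<close>.\<close>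
  define n m where "n = rec k" and "m = rec (Suc k)"
  define s where "s = m - n"
  have s: "s > 0" "m = n + s" using rec_less[of k] by (auto simp: s_def n_def m_def)
  have good: "(pl \<alpha> b ^^ i) (R + \<tau> n) \<le> of_int (P i)" if "i < m" "con i" for i
    using that nxt_least[of i n] rec_Suc[of k] by (simp add: le_P n_def m_def)
  have Fi: "(pl \<alpha> b ^^ i) (of_int (P n)) = (pl \<alpha> b ^^ (n + i)) (R + \<tau> n)" for i
    using \<tau>(2)[of n] by (metis add.commute comp_apply funpow_add)
  define e where "e = (pl \<alpha> b ^^ s) (of_int (P n)) - of_int (P m)"
  have "(pl \<alpha> b ^^ m) (R + \<tau> n) - r m \<le> \<tau> n / D 0 * D m"
    using \<tau>(1) good by (intro ext) auto
  also have "\<dots> \<le> \<tau> n0 / D 0 * D m"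
    using \<tau>_rec[of k] D_pos[of 0] D_pos[of m] by (intro mult_right_mono divide_right_mono) (auto simp: n_def)
  also have "\<dots> < \<epsilon>"
  proof -
    have "m \<ge> K" using k(1) strict_mono_imp_increasing[OF mono_rec, of "Suc k"] by (simp add: m_def)
    from K[OF this] show ?thesis using D_pos[of 0] \<tau>(1)[of n0] by (simp add: field_simps)
  qed
  finally have e_less: "e < \<epsilon>" using rP[of m] Fi[of s] s by (simp add: e_def)
  have e_pos: "e > 0"
    using nxt[of n] Fi[of s] s le_P[of m "\<tau> n"] rec_Suc[of k] by (simp add: e_def n_def m_def)
  have "\<exists>\<beta>\<ge>\<alpha> - e. \<beta> \<le> \<alpha> \<and> (pl \<beta> b ^^ s) (of_int (P n)) = of_int (P m)"
  proof (rule IVT')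
    show "(pl (\<alpha> - e) b ^^ s) (of_int (P n)) \<le> of_int (P m)"
      using pl_iter_speed_param[of b "\<alpha> - e" \<alpha> s "of_int (P n)"] b s e_pos by (simp add: e_def)
  qed (use e_pos in \<open>auto simp: e_def intro!: continuous_intros\<close>)
  then obtain \<beta> where \<beta>: "\<alpha> - e \<le> \<beta>" "\<beta> \<le> \<alpha>" and ret: "(pl \<beta> b ^^ s) (of_int (P n)) = of_int (P m)"
    by auto
  have y_gt: "(pl \<beta> b ^^ i) (of_int (P n)) > r (n + i)" if "i < s" for i
  proof (rule ccontr)
    assume "\<not> ?thesis"
    then have "(pl \<beta> b ^^ (s - i)) ((pl \<beta> b ^^ i) (of_int (P n))) \<le> (pl \<alpha> b ^^ (s - i)) (r (n + i))"
      using b \<beta> by (intro pl_iter_mono_param) auto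
    moreover have "(pl \<beta> b ^^ (s - i)) ((pl \<beta> b ^^ i) (of_int (P n))) = of_int (P m)"
      using ret that funpow_add[of "s - i" i "pl \<beta> b"] by simp
    moreover have "(pl \<alpha> b ^^ (s - i)) (r (n + i)) = r m"
      using that s funpow_add[of "s - i" "n + i" "pl \<alpha> b"] by (simp add: r_def add.commute)
    ultimately show False using rP[of m] by simp
  qed
  have y_le: "(pl \<beta> b ^^ i) (of_int (P n)) \<le> of_int (P (n + i))" if "i < s" "con (n + i)" for i
  proof -
    have "(pl \<beta> b ^^ i) (of_int (P n)) \<le> (pl \<alpha> b ^^ i) (of_int (P n))"
      using b \<beta> by (intro pl_iter_mono_param) auto
    also have "\<dots> \<le> of_int (P (n + i))" using good[of "n + i"] that s Fi[of i] by simp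
    finally show ?thesis .
  qed
  \<comment> \<open>The trap needs a left end \<open>u\<close> so close to \<open>P n\<close> that its images stay in the gaps too.\<close>
  have "\<forall>\<^sub>F x in at_left (of_int (P n)). \<forall>i\<in>{..<s}. (pl \<beta> b ^^ i) x > r (n + i)"
  proof (intro eventually_ball_finite ballI)
    fix i assume "i \<in> {..<s}"
    have "continuous_on UNIV (pl \<beta> b ^^ i)" using continuous_on_pl_iter[of UNIV "\<lambda>_. \<beta>" "\<lambda>_. b" "\<lambda>x. x" i] by simp
    then have "((pl \<beta> b ^^ i) \<longlongrightarrow> (pl \<beta> b ^^ i) (of_int (P n))) (at_left (of_int (P n)))"
      by (meson continuous_on_def UNIV_I tendsto_within_subset subset_UNIV)
    then show "\<forall>\<^sub>F x in at_left (of_int (P n)). (pl \<beta> b ^^ i) x > r (n + i)"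
      using y_gt[of i] \<open>i \<in> {..<s}\<close> by (intro order_tendstoD(1)) auto
  qed simp
  moreover have "\<forall>\<^sub>F x in at_left (real_of_int (P n)). x < of_int (P n)"
    by (auto simp: eventually_at_filter)
  ultimately have "\<forall>\<^sub>F x in at_left (real_of_int (P n)). x < of_int (P n) \<and> (\<forall>i\<in>{..<s}. (pl \<beta> b ^^ i) x > r (n + i))"
    by eventually_elim auto
  then obtain u where u: "u < of_int (P n)" "\<And>i. i < s \<Longrightarrow> (pl \<beta> b ^^ i) u > r (n + i)"
    using eventually_happens'[OF trivial_limit_at_left_real] by blast
  define q where "q = (of_int (P n) - u) / D n"
  have "(pl \<beta> b ^^ i) (of_int (P n)) - (pl \<beta> b ^^ i) u \<le> q * D (n + i)" if "i \<le> s" for i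
    using that
  proof (induct i)
    case 0
    show ?case using D_pos[of n] by (simp add: q_def)
  next
    case (Suc i)
    have "pl \<beta> b ((pl \<beta> b ^^ i) (of_int (P n))) - pl \<beta> b ((pl \<beta> b ^^ i) u) \<le> q * D (Suc (n + i))"
    proof (rule step)
      show "(pl \<beta> b ^^ i) u \<le> (pl \<beta> b ^^ i) (of_int (P n))" using u b by (intro pl_iter_mono) auto
      show "of_int (P (n + i)) - 1/2 \<le> (pl \<beta> b ^^ i) u \<and> (pl \<beta> b ^^ i) (of_int (P n)) \<le> of_int (P (n + i))"
        if "con (n + i)"
        using u(2)[of i] y_le[of i] that Suc.prems by (auto simp: con_def)
      show "(pl \<beta> b ^^ i) (of_int (P n)) - (pl \<beta> b ^^ i) u \<le> q * D (n + i)" using Suc by simp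
    qed
    then show ?case by simp
  qed
  from this[of s] have "of_int (P m) - (pl \<beta> b ^^ s) u \<le> q * D m" using ret s by simp
  also have "\<dots> < q * D n"
    using k(2) u(1) D_pos[of n] by (intro mult_strict_left_mono) (auto simp: q_def n_def m_def)
  also have "\<dots> = of_int (P n) - u" using D_pos[of n] by (simp add: q_def)
  finally have "trap \<beta> b" unfolding trap_def
    using s u(1) ret by (intro exI[of _ s] conjI exI[of _ "P m - P n"] exI[of _ u] exI[of _ "of_int (P n)"]) auto
  moreover have "\<bar>\<beta> - \<alpha>\<bar> < \<epsilon>" using \<beta> e_less by auto
  ultimately show "\<exists>\<alpha>' b'. \<bar>\<alpha>' - \<alpha>\<bar> < \<epsilon> \<and> \<bar>b' - b\<bar> < \<epsilon> \<and> 0 \<le> b' \<and> b' < 1 \<and> trap \<alpha>' b'"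
    using b \<epsilon> by (intro exI[of _ \<beta>] exI[of _ b]) auto
qed

section \<open>Fibers of the semiconjugacy\<close>

definition normalized_parameter :: "circle \<Rightarrow> real \<Rightarrow> real"
  where "normalized_parameter a b = crep a - of_int \<lfloor>crep a - b / 2\<rfloor>"

lemma to_circle_normalized_parameter: "to_circle (normalized_parameter a b) = a"
proof -
  have "to_circle (normalized_parameter a b) = to_circle (crep a)"
    by (simp add: normalized_parameter_def to_circle_eq_iff)
  then show ?thesis by (simp add: to_circle_crep)
qed

lemma lift_map_eq_pl: "lift_map a b = pl (normalized_parameter a b) b"
  by (rule ext) (simp add: lift_map_eq pl_def normalized_parameter_def)

lemma Phi_iter: "Phi a b ((lift_map a b ^^ n) x) = 2 ^ n * Phi a b x"
proof (induct n)
  case (Suc n)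
  let ?F = "lift_map a b" and ?y = "(lift_map a b ^^ n) x"
  have "(\<lambda>k. 2 * ((?F ^^ Suc k) ?y / 2 ^ Suc k)) \<longlonglongrightarrow> 2 * Phi a b ?y"
    by (intro tendsto_mult_left LIMSEQ_Suc Phi_LIMSEQ)
  moreover have "(\<lambda>k. 2 * ((?F ^^ Suc k) ?y / 2 ^ Suc k)) = (\<lambda>k. (?F ^^ k) (?F ?y) / 2 ^ k)"
    by (simp add: funpow_swap1)
  ultimately have "Phi a b (?F ?y) = 2 * Phi a b ?y"
    using Phi_LIMSEQ LIMSEQ_unique by metis
  with Suc show ?case by simp
qed simp

context
  fixes a :: circle and b :: real
  assumes b: "0 \<le> b" "b \<le> 1"
begin

lemma Phi_mono: "x \<le> y \<Longrightarrow> Phi a b x \<le> Phi a b y"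
  using b by (intro LIMSEQ_le[OF Phi_LIMSEQ Phi_LIMSEQ] exI[of _ 0] allI impI divide_right_mono)
    (auto simp: lift_map_eq_pl intro!: pl_iter_mono)

lemma Phi_near_identity: "\<bar>Phi a b x - x\<bar> \<le> \<bar>Phi a b 0\<bar> + 1"
proof -
  have "Phi a b x = Phi a b (frac x) + of_int \<lfloor>x\<rfloor>"
    using Phi_add_int[of a b "frac x" "\<lfloor>x\<rfloor>"] by (simp add: frac_def)
  moreover have "Phi a b 0 \<le> Phi a b (frac x)" "Phi a b (frac x) \<le> Phi a b 0 + 1"
    using Phi_mono[of 0 "frac x"] Phi_mono[of "frac x" 1] Phi_add_int[of a b 0 1] frac_lt_1[of x] by auto
  moreover have "x = of_int \<lfloor>x\<rfloor> + frac x" "0 \<le> frac x" "frac x < 1"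
    by (simp_all add: frac_def frac_lt_1[unfolded frac_def])
  ultimately show ?thesis by linarith
qed

text \<open>\<^const>\<open>Phi\<close> stays within a bounded distance of the identity and turns \<open>F\<^sup>n\<close> into
multiplication by \<open>2\<^sup>n\<close>. Continuity, and the fact that points whose orbits stay within a bounded
distance are identified, both follow from this estimate.\<close>
lemma Phi_diff_le:
  "\<bar>Phi a b x - Phi a b y\<bar> \<le> (\<bar>(lift_map a b ^^ n) x - (lift_map a b ^^ n) y\<bar> + 2 * (\<bar>Phi a b 0\<bar> + 1)) / 2 ^ n"
proof -
  have "2 ^ n * \<bar>Phi a b x - Phi a b y\<bar> = \<bar>Phi a b ((lift_map a b ^^ n) x) - Phi a b ((lift_map a b ^^ n) y)\<bar>"
    unfolding Phi_iter by (simp add: abs_mult flip: right_diff_distrib)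
  also have "\<dots> \<le> \<bar>(lift_map a b ^^ n) x - (lift_map a b ^^ n) y\<bar> + 2 * (\<bar>Phi a b 0\<bar> + 1)"
  proof -
    have "\<bar>A - B\<bar> \<le> \<bar>u - v\<bar> + 2 * C" if "\<bar>A - u\<bar> \<le> C" "\<bar>B - v\<bar> \<le> C" for A B u v C :: real
      using that by linarith
    then show ?thesis using Phi_near_identity by blast
  qed
  finally show ?thesis by (simp add: field_simps)
qed

lemma continuous_Phi: "continuous_on S (Phi a b)"
proof (rule continuous_on_subset[OF continuous_at_imp_continuous_on subset_UNIV], intro ballI)
  fix y
  have "\<exists>d>0. \<forall>x. dist x y < d \<longrightarrow> dist (Phi a b x) (Phi a b y) < e" if e: "e > 0" for e
  proof -
    let ?C = "1 + 2 * (\<bar>Phi a b 0\<bar> + 1)"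
    obtain n where "?C / e < 2 ^ n" using real_arch_pow[of 2] by auto
    then have n: "?C / 2 ^ n < e" using e by (simp add: field_simps)
    obtain d where d: "d > 0" "\<And>x. \<bar>x - y\<bar> < d \<Longrightarrow> \<bar>(lift_map a b ^^ n) x - (lift_map a b ^^ n) y\<bar> < 1"
      using pl_iter_close[of 1 "normalized_parameter a b" b y n] by (auto simp: lift_map_eq_pl)
    have "\<bar>Phi a b x - Phi a b y\<bar> < e" if "\<bar>x - y\<bar> < d" for x
    proof -
      have "(\<bar>(lift_map a b ^^ n) x - (lift_map a b ^^ n) y\<bar> + 2 * (\<bar>Phi a b 0\<bar> + 1)) / 2 ^ n \<le> ?C / 2 ^ n"
        using d(2)[OF that] by (intro divide_right_mono) auto
      with n Phi_diff_le[of x y n] show ?thesis by linarith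
    qed
    with d(1) show ?thesis by (auto simp: dist_real_def)
  qed
  then show "isCont (Phi a b) y" unfolding continuous_at_eps_delta by blast
qed

lemma Phi_eq_if_bounded:
  assumes "\<And>n. \<bar>(lift_map a b ^^ n) x - (lift_map a b ^^ n) y\<bar> \<le> B"
  shows "Phi a b x = Phi a b y"
proof (rule ccontr)
  assume "Phi a b x \<noteq> Phi a b y"
  then have e: "\<bar>Phi a b x - Phi a b y\<bar> > 0" by simp
  let ?C = "B + 2 * (\<bar>Phi a b 0\<bar> + 1)"
  obtain n where "?C / \<bar>Phi a b x - Phi a b y\<bar> < 2 ^ n" using real_arch_pow[of 2] by auto
  then have n: "?C / 2 ^ n < \<bar>Phi a b x - Phi a b y\<bar>" using e by (simp add: field_simps)
  have "(\<bar>(lift_map a b ^^ n) x - (lift_map a b ^^ n) y\<bar> + 2 * (\<bar>Phi a b 0\<bar> + 1)) / 2 ^ n \<le> ?C / 2 ^ n"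
    using assms[of n] by (intro divide_right_mono) auto
  with n Phi_diff_le[of x y n] show False by linarith
qed

lemma Phi_fiber_endpoints:
  assumes "Phi a b x = t"
  obtains L R where "Phi a b L = t" "Phi a b R = t" "\<And>y. Phi a b y = t \<Longrightarrow> L \<le> y \<and> y \<le> R"
proof -
  let ?S = "{y. Phi a b y = t}"
  have "closed ?S" by (intro closed_Collect_eq continuous_Phi continuous_intros)
  moreover have near: "t - (\<bar>Phi a b 0\<bar> + 1) \<le> y \<and> y \<le> t + (\<bar>Phi a b 0\<bar> + 1)" if "y \<in> ?S" for y
    using Phi_near_identity[of y] that by (simp add: abs_le_iff)
  moreover have "bdd_above ?S" using near unfolding bdd_above_def by blast
  moreover have "bdd_below ?S" using near unfolding bdd_below_def by blast
  moreover have "?S \<noteq> {}" using assms by auto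
  ultimately have "Sup ?S \<in> ?S \<and> Inf ?S \<in> ?S"
    by (intro conjI closed_contains_Sup closed_contains_Inf)
  moreover have "Inf ?S \<le> y \<and> y \<le> Sup ?S" if "Phi a b y = t" for y
    using that \<open>bdd_above ?S\<close> \<open>bdd_below ?S\<close> by (simp add: cInf_lower cSup_upper)
  ultimately show ?thesis using that[of "Inf ?S" "Sup ?S"] by blast
qed

text \<open>The fibers of \<^const>\<open>Phi\<close> over \<open>2\<^sup>i t\<close> are disjoint modulo 1 when \<open>t\<close> is not preperiodic under
doubling, and modulo 1 there are only \<open>K\<close> multiples of \<open>1/K\<close> to share among them. For large \<open>K\<close> this
says that the lengths of the fibers tend to 0, for \<open>K = 2\<close> that they eventually avoid the turning
points.\<close>
lemma finite_visits_to_lattice: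
  fixes K :: nat
  assumes K: "K > 0" and not_preperiodic: "\<And>i j. i < j \<Longrightarrow> 2 ^ j * t - 2 ^ i * t \<notin> \<int>"
  shows "finite {i. \<exists>k::int. Phi a b (of_int k / real K) = 2 ^ i * t}"
proof -
  let ?V = "{i. \<exists>k::int. Phi a b (of_int k / real K) = 2 ^ i * t}"
  have "\<forall>i\<in>?V. \<exists>k::int. Phi a b (of_int k / real K) = 2 ^ i * t" by blast
  then obtain k :: "nat \<Rightarrow> int" where k: "\<And>i. i \<in> ?V \<Longrightarrow> Phi a b (of_int (k i) / real K) = 2 ^ i * t"
    unfolding bchoice_iff by blast
  have key: "2 ^ j * t - 2 ^ i * t \<in> \<int>" if ij: "i \<in> ?V" "j \<in> ?V" "k i mod int K = k j mod int K" for i j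
  proof -
    have "int K dvd k j - k i" using ij(3) by (metis mod_eq_dvd_iff)
    then obtain q where "k j = k i + int K * q" by (metis add.commute diff_add_cancel dvdE)
    then have "of_int (k j) / real K = of_int (k i) / real K + of_int q"
      using K by (simp add: field_simps)
    then have "Phi a b (of_int (k j) / real K) = Phi a b (of_int (k i) / real K) + of_int q"
      using Phi_add_int by metis
    then show ?thesis using k ij by simp
  qed
  have "inj_on (\<lambda>i. k i mod int K) ?V"
  proof (rule inj_onI)
    fix i j assume "i \<in> ?V" "j \<in> ?V" "k i mod int K = k j mod int K"
    then have "2 ^ j * t - 2 ^ i * t \<in> \<int>" "2 ^ i * t - 2 ^ j * t \<in> \<int>" using key by auto
    then show "i = j" using not_preperiodic[of i j] not_preperiodic[of j i] by (cases i j rule: linorder_cases) auto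
  qed
  moreover have "(\<lambda>i. k i mod int K) ` ?V \<subseteq> {0..<int K}" using K by auto
  ultimately show ?thesis using finite_imageD finite_subset by blast
qed

end

text \<open>If \<open>t = \<Phi> x = \<Phi> y\<close> is preperiodic under doubling modulo 1, a non-degenerate fiber \<open>[p, q]\<close> is mapped onto
itself by some \<open>h = F\<^sup>s - m\<close>. If \<open>h z > z\<close> somewhere in it, then \<open>z\<close> and \<open>q\<close> bound a trap. If \<open>h z < z\<close>,
then a small increase of \<open>\<alpha>\<close> lifts the graph over the diagonal at \<open>p\<close> and makes \<open>p\<close> and \<open>z\<close> bound a
trap. Otherwise \<open>h\<close> is the identity on \<open>[p, q]\<close>. If \<open>t\<close> is not preperiodic, the fiber of \<open>t\<close> is a
wandering interval.\<close>
lemma noninjective_Phi_imp_near_sinks: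
  assumes b: "0 \<le> b" "b \<le> 1" and xy: "x < y" "Phi a b x = Phi a b y"
  shows "near_sinks (normalized_parameter a b) b"
proof (cases "b = 1")
  case True
  then show ?thesis using flat_piece_imp_near_sinks by simp
next
  case False
  with b have b1: "0 \<le> b" "b < 1" by auto
  define \<alpha> where "\<alpha> = normalized_parameter a b"
  let ?F = "pl \<alpha> b"
  have F: "lift_map a b = ?F" by (simp add: lift_map_eq_pl \<alpha>_def)
  have PF: "Phi a b ((?F ^^ n) z) = 2 ^ n * Phi a b z" for n z using Phi_iter[of a b n z] by (simp add: F)
  have surj: "\<exists>x. (?F ^^ n) x = z" for n z
  proof -
    define N where "N = \<lceil>\<bar>(?F ^^ n) 0\<bar> + \<bar>z\<bar>\<rceil>"
    have N: "of_int N \<ge> \<bar>(?F ^^ n) 0\<bar> + \<bar>z\<bar>" unfolding N_def by linarith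
    then have "1 * of_int N \<le> 2 ^ n * (of_int N :: real)" by (intro mult_right_mono) auto
    then have "(?F ^^ n) (of_int (- N)) \<le> z" "z \<le> (?F ^^ n) (of_int N)"
      using N pl_iter_add_int[where \<alpha> = \<alpha> and b = b and n = n and x = 0 and k = N]
        pl_iter_add_int[where \<alpha> = \<alpha> and b = b and n = n and x = 0 and k = "- N"] by auto
    moreover have "of_int (- N) \<le> real_of_int N" using N by simp
    ultimately show ?thesis
      using IVT'[of "?F ^^ n" "of_int (- N)" z "of_int N"]
        continuous_on_pl_iter[of "{of_int (- N)..of_int N}" "\<lambda>_. \<alpha>" "\<lambda>_. b" "\<lambda>x. x" n] by auto
  qed
  define t where "t = Phi a b x"
  have "near_sinks \<alpha> b"
  proof (cases "\<exists>i j. i < j \<and> 2 ^ j * t - 2 ^ i * t \<in> \<int>")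
    case True
    then obtain i j and m :: int where ij: "i < j" and m: "2 ^ j * t - 2 ^ i * t = of_int m"
      by (auto elim: Ints_cases)
    define s where "s = j - i"
    have s: "s > 0" using ij by (simp add: s_def)
    define t' where "t' = 2 ^ i * t"
    have t': "2 ^ s * t' = t' + of_int m" using m ij by (simp add: t'_def s_def flip: power_add mult.assoc)
    have eqs: "Phi a b ((?F ^^ i) x) = t'" "Phi a b ((?F ^^ i) y) = t'" using xy by (simp_all add: PF t'_def t_def)
    obtain p q where pq: "Phi a b p = t'" "Phi a b q = t'" and max: "\<And>z. Phi a b z = t' \<Longrightarrow> p \<le> z \<and> z \<le> q"
      using Phi_fiber_endpoints[OF b eqs(1)] by metis
    have "p < q" using max[OF eqs(1)] max[OF eqs(2)] pl_iter_strict_mono[OF b1 xy(1), where \<alpha> = \<alpha> and n = i] by linarith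
    define h where "h z = (?F ^^ s) z - of_int m" for z
    have h_fib: "Phi a b (h z) = t' \<longleftrightarrow> Phi a b z = t'" for z
    proof -
      have "Phi a b ((?F ^^ s) z) = Phi a b (h z) + of_int m"
        using Phi_add_int[of a b "h z" m] by (simp add: h_def)
      then have "Phi a b (h z) = 2 ^ s * Phi a b z - of_int m" by (simp add: PF)
      with t' show ?thesis by (auto simp: algebra_simps)
    qed
    have h_mono: "z \<le> w \<Longrightarrow> h z \<le> h w" for z w using b by (auto simp: h_def intro!: pl_iter_mono)
    have h_surj: "\<exists>x. h x = z" for z unfolding h_def by (metis add_diff_cancel_right' surj)
    have hp: "h p = p"
    proof (rule antisym)
      obtain z where z: "h z = p" using h_surj by blast
      then have "p \<le> z" using h_fib[of z] pq max by auto
      then show "h p \<le> p" using h_mono z by metis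
      show "p \<le> h p" using h_fib[of p] pq max by auto
    qed
    have hq: "h q = q"
    proof (rule antisym)
      obtain z where z: "h z = q" using h_surj by blast
      then have "z \<le> q" using h_fib[of z] pq max by auto
      then show "q \<le> h q" using h_mono z by metis
      show "h q \<le> q" using h_fib[of q] pq max by auto
    qed
    consider z where "p \<le> z" "z \<le> q" "h z > z" | z where "p \<le> z" "z \<le> q" "h z < z"
      | "\<And>z. p \<le> z \<Longrightarrow> z \<le> q \<Longrightarrow> h z = z" by (metis linorder_neqE_linordered_idom)
    then show ?thesis
    proof cases
      case 1
      then have "z < q" using hq by (metis less_irrefl order_le_less)
      then have "trap \<alpha> b" unfolding trap_def using 1 s hq
        by (intro exI[of _ s] conjI exI[of _ m] exI[of _ z] exI[of _ q]) (auto simp: h_def)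
      then show ?thesis using b1 trap_imp_near_sinks by blast
    next
      case 2
      then have pz: "p < z" using hp by (metis less_irrefl order_le_less)
      show ?thesis
      proof (rule trap_near_imp_near_sinks)
        fix \<epsilon> :: real assume \<epsilon>: "\<epsilon> > 0"
        obtain d where d: "d > 0" "\<And>\<beta>. \<bar>\<beta> - \<alpha>\<bar> < d \<Longrightarrow> \<bar>(pl \<beta> b ^^ s) z - (pl \<alpha> b ^^ s) z\<bar> < z - h z"
          using pl_iter_close[of "z - h z" \<alpha> b z s] 2 by auto
        define \<beta> where "\<beta> = \<alpha> + min d \<epsilon> / 2"
        have \<beta>: "\<alpha> < \<beta>" "\<bar>\<beta> - \<alpha>\<bar> < d" "\<bar>\<beta> - \<alpha>\<bar> < \<epsilon>" using d \<epsilon> by (auto simp: \<beta>_def)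
        have "(pl \<beta> b ^^ s) p > p + of_int m"
          using pl_iter_speed_param[of b \<alpha> \<beta> s p] b s \<beta> hp by (simp add: h_def)
        moreover have "(pl \<beta> b ^^ s) z \<le> z + of_int m" using d(2)[OF \<beta>(2)] by (simp add: h_def)
        ultimately have "trap \<beta> b" unfolding trap_def using s pz by blast
        with \<beta> b1 \<epsilon> show "\<exists>\<alpha>' b'. \<bar>\<alpha>' - \<alpha>\<bar> < \<epsilon> \<and> \<bar>b' - b\<bar> < \<epsilon> \<and> 0 \<le> b' \<and> b' < 1 \<and> trap \<alpha>' b'"
          by (intro exI[of _ \<beta>] exI[of _ b]) auto
      qed
    next
      case 3
      then show ?thesis
        using periodic_interval_imp_near_sinks[OF b1 s \<open>p < q\<close>, of \<alpha> m] by (force simp: h_def)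
    qed
  next
    case False
    then have np: "\<And>i j. i < j \<Longrightarrow> 2 ^ j * t - 2 ^ i * t \<notin> \<int>" by blast
    obtain L R where LR: "Phi a b L = t" "Phi a b R = t" and max: "\<And>z. Phi a b z = t \<Longrightarrow> L \<le> z \<and> z \<le> R"
      using Phi_fiber_endpoints[OF b, of a x t] t_def by metis
    have "L < R" using max[of x] max[of y] xy by (simp add: t_def)
    have visit: "\<exists>k::int. Phi a b (of_int k / real K) = 2 ^ i * t"
      if "(?F ^^ i) L \<le> of_int k / real K" "of_int k / real K \<le> (?F ^^ i) R" for i K and k :: int
      using Phi_mono[OF b that(1), of a] Phi_mono[OF b that(2), of a] by (auto simp: PF LR intro!: exI[of _ k])
    have shrink: "(\<lambda>i. (?F ^^ i) R - (?F ^^ i) L) \<longlonglongrightarrow> 0"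
    proof (rule LIMSEQ_I)
      fix e :: real assume "e > 0"
      then obtain K where K: "K > 0" "1 / real K < e" using nat_approx_posE by (metis zero_less_Suc)
      obtain N where N: "\<And>i. \<exists>k::int. Phi a b (of_int k / real K) = 2 ^ i * t \<Longrightarrow> i < N"
        using finite_visits_to_lattice[OF b K(1) np, of a] by (auto simp: finite_nat_set_iff_bounded)
      have "norm ((?F ^^ i) R - (?F ^^ i) L - 0) < e" if "i \<ge> N" for i
      proof (rule ccontr)
        have pos: "(?F ^^ i) L < (?F ^^ i) R" using pl_iter_strict_mono[OF b1 \<open>L < R\<close>] .
        assume "\<not> ?thesis"
        with pos K have big: "(?F ^^ i) R - (?F ^^ i) L > 1 / real K" by simp
        define k where "k = \<lceil>(?F ^^ i) L * real K\<rceil>"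
        have "(?F ^^ i) L * real K \<le> of_int k" "of_int k \<le> (?F ^^ i) L * real K + 1"
          unfolding k_def by linarith+
        then have "(?F ^^ i) L \<le> of_int k / real K" "of_int k / real K \<le> (?F ^^ i) R"
          using big K by (auto simp: field_simps)
        with visit N[of i] that show False by fastforce
      qed
      then show "\<exists>N. \<forall>i\<ge>N. norm ((?F ^^ i) R - (?F ^^ i) L - 0) < e" by blast
    qed
    obtain N where N: "\<And>i. \<exists>k::int. Phi a b (of_int k / real 2) = 2 ^ i * t \<Longrightarrow> i < N"
      using finite_visits_to_lattice[OF b _ np, of 2 a] by (auto simp: finite_nat_set_iff_bounded)
    have shift: "(?F ^^ i) ((?F ^^ N) z) = (?F ^^ (i + N)) z" for i z by (simp add: funpow_add)
    show ?thesis
    proof (rule wandering_interval_imp_near_sinks[OF b1])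
      show "(?F ^^ N) L < (?F ^^ N) R" using pl_iter_strict_mono[OF b1 \<open>L < R\<close>] .
      show "\<not> ((?F ^^ i) ((?F ^^ N) L) \<le> of_int k / 2 \<and> of_int k / 2 \<le> (?F ^^ i) ((?F ^^ N) R))" for i and k :: int
        using visit[of "i + N" k 2] N[of "i + N"] by (auto simp: shift)
      show "(\<lambda>i. (?F ^^ i) ((?F ^^ N) R) - (?F ^^ i) ((?F ^^ N) L)) \<longlonglongrightarrow> 0"
        unfolding shift using LIMSEQ_ignore_initial_segment[OF shrink] .
      show "\<exists>i. (?F ^^ i) ((?F ^^ N) R + \<delta>) - (?F ^^ i) ((?F ^^ N) R) > B" if "\<delta> > 0" for \<delta> B
      proof (rule ccontr)
        assume "\<not> ?thesis"
        then have le: "(?F ^^ i) ((?F ^^ N) R + \<delta>) - (?F ^^ i) ((?F ^^ N) R) \<le> B" for i by (auto simp: not_less)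
        moreover have "(?F ^^ i) ((?F ^^ N) R) \<le> (?F ^^ i) ((?F ^^ N) R + \<delta>)" for i
          using b that by (intro pl_iter_mono) auto
        ultimately have "Phi a b ((?F ^^ N) R + \<delta>) = Phi a b ((?F ^^ N) R)"
          by (intro Phi_eq_if_bounded[OF b, where B = B]) (simp add: F)
        moreover obtain z where z: "(?F ^^ N) z = (?F ^^ N) R + \<delta>" using surj by blast
        ultimately have "Phi a b z = t" using PF[of N z] PF[of N R] LR by simp
        then have "z \<le> R" using max by blast
        then have "(?F ^^ N) z \<le> (?F ^^ N) R" using b by (intro pl_iter_mono) auto
        with z that show False by simp
      qed
    qed
  qed
  then show ?thesis by (simp add: \<alpha>_def)
qed

section \<open>The conjugacy\<close>

text \<open>The universal property of the quotient topology.\<close>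
lemma continuous_on_circle_iff:
  fixes g :: "circle \<Rightarrow> circle"
  shows "continuous_on UNIV g \<longleftrightarrow> continuous_on UNIV (\<lambda>x. g (to_circle x))"
  unfolding continuous_on_open_vimage[OF open_UNIV] open_circle_def
  by (simp add: vimage_def)

lemma phi_semiconjugacy: "phi a b \<circ> fmap a b = doubling \<circ> phi a b"
proof
  fix z
  obtain x where z: "z = to_circle x" by (metis to_circle_crep)
  have "phi a b (fmap a b z) = to_circle (Phi a b (lift_map a b x))"
    using is_lift_lift_map[of a b] by (simp add: z is_lift_def flip: phi_to_circle)
  also have "\<dots> = to_circle (2 * Phi a b x)" using Phi_iter[of a b 1 x] by simp
  also have "\<dots> = doubling (to_circle (Phi a b x))"
    by (simp add: doubling_def crep_to_circle to_circle_eq_iff frac_def)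
  also have "\<dots> = doubling (phi a b z)" by (simp add: z phi_to_circle)
  finally show "(phi a b \<circ> fmap a b) z = (doubling \<circ> phi a b) z" by simp
qed

lemma phi_homeomorphism:
  assumes b: "0 \<le> b" "b \<le> 1" and inj: "inj (Phi a b)"
  shows "\<exists>g. homeomorphism UNIV UNIV (phi a b) g"
proof -
  have surj: "\<exists>x. Phi a b x = t" for t
  proof -
    let ?C = "\<bar>Phi a b 0\<bar> + 1"
    have "Phi a b (t - ?C) \<le> t" "t \<le> Phi a b (t + ?C)"
      using Phi_near_identity[OF b, of a "t - ?C"] Phi_near_identity[OF b, of a "t + ?C"]
      unfolding abs_le_iff by linarith+
    then show ?thesis using IVT'[of "Phi a b" "t - ?C" t "t + ?C"] continuous_Phi[OF b] by force
  qed
  define \<Psi> where "\<Psi> = inv (Phi a b)"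
  have PhiPsi: "Phi a b (\<Psi> t) = t" for t using surj unfolding \<Psi>_def by (metis f_inv_into_f rangeI)
  have PsiPhi: "\<Psi> (Phi a b x) = x" for x using inj by (simp add: \<Psi>_def)
  have Psi_add_int: "\<Psi> (t + of_int k) = \<Psi> t + of_int k" for t k
    by (metis PhiPsi PsiPhi Phi_add_int)
  have "continuous_on UNIV \<Psi>"
  proof -
    have "open (\<Psi> -` U)" if "open U" for U
    proof -
      have "\<Psi> -` U = Phi a b ` U" using PhiPsi PsiPhi by (auto simp: image_iff) metis
      moreover have "open (Phi a b ` U)"
        using that continuous_Phi[OF b] inj by (intro injective_into_1d_imp_open_map_UNIV[of U UNIV]) auto
      ultimately show ?thesis by simp
    qed
    then show ?thesis by (simp add: continuous_on_open_vimage)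
  qed
  define g where "g z = to_circle (\<Psi> (crep z))" for z
  have g: "g (to_circle t) = to_circle (\<Psi> t)" for t
    using Psi_add_int[of "frac t" "\<lfloor>t\<rfloor>"] by (simp add: g_def crep_to_circle frac_def to_circle_eq_iff)
  have phi_g: "phi a b (g z) = z" and g_phi: "g (phi a b z) = z" for z
    by (metis g phi_to_circle PhiPsi to_circle_crep) (metis g phi_to_circle PsiPhi to_circle_crep)
  have "continuous_on UNIV (phi a b)"
    unfolding continuous_on_circle_iff phi_to_circle
    by (rule continuous_on_compose2[OF continuous_to_circle continuous_Phi[OF b]]) auto
  moreover have "continuous_on UNIV g"
    unfolding continuous_on_circle_iff g
    by (rule continuous_on_compose2[OF continuous_to_circle \<open>continuous_on UNIV \<Psi>\<close>]) auto
  ultimately have "homeomorphism UNIV UNIV (phi a b) g"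
    using phi_g g_phi by (intro homeomorphismI) auto
  then show ?thesis by blast
qed

theorem theorem6p2:
  fixes a :: circle and b :: real
  assumes "b \<in> {0..1}"
    and "(a, b) \<notin> closure hyperbolic_set"
  shows "(\<exists>g. homeomorphism UNIV UNIV (phi a b) g) \<and>
         phi a b \<circ> fmap a b = doubling \<circ> phi a b"
proof -
  have b: "0 \<le> b" "b \<le> 1" using assms(1) by auto
  have "\<not> near_sinks (normalized_parameter a b) b"
    using near_sinks_imp_closure assms(2) to_circle_normalized_parameter by metis
  then have "Phi a b x \<noteq> Phi a b y" if "x < y" for x y
    using noninjective_Phi_imp_near_sinks[OF b that] by blast
  then have "inj (Phi a b)" by (metis injI linorder_neqE_linordered_idom)
  with b show ?thesis using phi_homeomorphism phi_semiconjugacy by blast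
qed

end
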